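(* Let $n\ge2$ be an integer and let $L:H_0^1(0,1)\to H^{-1}(0,1)$ be given by $Lu=-u_{xx}-4n\sum_{k=1}^{n-1}\delta_{k/n}u$. Then $L$ has at least one negative eigenvalue, the number of negative eigenvalues of $L$ is finite, and $0$ is not an eigenvalue of $L$.
   Context: For $x_0\in(0,1)$ and $u\in H_0^1(0,1)$ (identified with its continuous representative), $\delta_{x_0}u\in H^{-1}(0,1)$ is defined by $\langle\delta_{x_0}u,\varphi\rangle_{(H^{-1},H_0^1)}=u(x_0)\varphi(x_0)$ for $\varphi\in H_0^1(0,1)$. $L$ is regarded as an unbounded operator in $H^{-1}(0,1)$ with domain $H_0^1(0,1)$; a number $\lambda\in\mathbb{R}$ is an eigenvalue if there is $U\in H_0^1(0,1)$, $U\ne0$, with $LU=\lambda U$ in $H^{-1}(0,1)$. *)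

theory Defs
  imports "HOL-Analysis.Analysis"
begin

abbreviation leb01 :: "real measure" where
  "leb01 \<equiv> lebesgue_on {0<..<1}"

definition L2_01 :: "(real \<Rightarrow> real) set" where
  "L2_01 = {f. f \<in> borel_measurable leb01 \<and> integrable leb01 (\<lambda>x. (f x)\<^sup>2)}"

text \<open>The test functions of class C-infinity with compact support in (0,1), as functions on the
  whole line.\<close>

definition test_01 :: "(real \<Rightarrow> real) set" where
  "test_01 = {\<phi>. (\<forall>k. (deriv ^^ k) \<phi> differentiable_on UNIV) \<and>
                  (\<exists>a b. 0 < a \<and> b < 1 \<and> (\<forall>x. x \<notin> {a..b} \<longrightarrow> \<phi> x = 0))}"

definition has_weak_deriv :: "(real \<Rightarrow> real) \<Rightarrow> (real \<Rightarrow> real) \<Rightarrow> bool" where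
  "has_weak_deriv u g \<longleftrightarrow>
     (\<forall>\<phi>\<in>test_01. (LINT x|leb01. u x * deriv \<phi> x) = - (LINT x|leb01. g x * \<phi> x))"

definition H1_01 :: "(real \<Rightarrow> real) set" where
  "H1_01 = {u \<in> L2_01. \<exists>g\<in>L2_01. has_weak_deriv u g}"

text \<open>The weak derivative is unique only up to null sets; everything below depends on it only
  through integrals, so any choice will do.\<close>

definition weak_deriv :: "(real \<Rightarrow> real) \<Rightarrow> real \<Rightarrow> real" where
  "weak_deriv u = (SOME g. g \<in> L2_01 \<and> has_weak_deriv u g)"

definition H1_norm :: "(real \<Rightarrow> real) \<Rightarrow> real" where
  "H1_norm u = sqrt ((LINT x|leb01. (u x)\<^sup>2) + (LINT x|leb01. (weak_deriv u x)\<^sup>2))"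

text \<open>The closure of the test functions in the H1 norm. Each class is represented by its unique
  continuous representative on (0,1), extended by zero, so that equality of elements is equality of
  functions and point values in (0,1) make sense. The boundary condition comes from the closure,
  not from the extension.\<close>

definition H01 :: "(real \<Rightarrow> real) set" where
  "H01 = {u \<in> H1_01. continuous_on {0<..<1} u \<and> (\<forall>x. x \<notin> {0<..<1} \<longrightarrow> u x = 0) \<and>
           (\<exists>\<phi>. (\<forall>j. \<phi> j \<in> test_01) \<and> (\<lambda>j::nat. H1_norm (\<lambda>x. u x - \<phi> j x)) \<longlonglongrightarrow> 0)}"

text \<open>The dual space of \<open>H01\<close>. Functionals are made extensional, so that equality in the dual
  space is equality of functions.\<close>

definition Hm1 :: "((real \<Rightarrow> real) \<Rightarrow> real) set" where
  "Hm1 = {F \<in> extensional H01.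
           (\<forall>\<phi>\<in>H01. \<forall>\<psi>\<in>H01. F (\<lambda>x. \<phi> x + \<psi> x) = F \<phi> + F \<psi>) \<and>
           (\<forall>c. \<forall>\<phi>\<in>H01. F (\<lambda>x. c * \<phi> x) = c * F \<phi>) \<and>
           (\<exists>C. \<forall>\<phi>\<in>H01. \<bar>F \<phi>\<bar> \<le> C * H1_norm \<phi>)}"

text \<open>The embedding of \<open>H01\<close> into \<open>Hm1\<close> through the pivot space L2(0,1).\<close>

definition Hm1_of :: "(real \<Rightarrow> real) \<Rightarrow> (real \<Rightarrow> real) \<Rightarrow> real" where
  "Hm1_of u = (\<lambda>\<phi>\<in>H01. LINT x|leb01. u x * \<phi> x)"

text \<open>The distribution \<open>- u\<^sub>x\<^sub>x\<close>, extended by continuity from test functions to \<open>H01\<close>.\<close>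

definition neg_dxx :: "(real \<Rightarrow> real) \<Rightarrow> (real \<Rightarrow> real) \<Rightarrow> real" where
  "neg_dxx u = (\<lambda>\<phi>\<in>H01. LINT x|leb01. weak_deriv u x * weak_deriv \<phi> x)"

definition delta_mult :: "real \<Rightarrow> (real \<Rightarrow> real) \<Rightarrow> (real \<Rightarrow> real) \<Rightarrow> real" where
  "delta_mult x0 u = (\<lambda>\<phi>\<in>H01. u x0 * \<phi> x0)"

definition L_op :: "nat \<Rightarrow> (real \<Rightarrow> real) \<Rightarrow> (real \<Rightarrow> real) \<Rightarrow> real" where
  "L_op n u = (\<lambda>\<phi>\<in>H01. neg_dxx u \<phi>
                 - 4 * real n * (\<Sum>k = 1..n - 1. delta_mult (real k / real n) u \<phi>))"

text \<open>Eigenvalues of an operator in \<open>Hm1\<close> with domain \<open>H01\<close>.\<close>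

definition is_eigenvalue ::
    "((real \<Rightarrow> real) \<Rightarrow> ((real \<Rightarrow> real) \<Rightarrow> real)) \<Rightarrow> real \<Rightarrow> bool" where
  "is_eigenvalue T \<mu> \<longleftrightarrow>
     (\<exists>U\<in>H01. U \<noteq> (\<lambda>x. 0) \<and> T U \<in> Hm1 \<and> T U = (\<lambda>\<phi>\<in>H01. \<mu> * Hm1_of U \<phi>))"

end

(* With h = 1/n, for a profile \<sigma> with \<sigma>'' = q \<sigma>, \<sigma>(0) = 0, \<sigma>'(0) = 1, let
   h_k(x) = \<sigma>(h - |x - k/n|) near k/n and 0 elsewhere. Integration by parts gives, for v in H01,
     (h_k', v') + q (h_k, v) = 2 \<sigma>'(h) v(k/n) - v((k-1)/n) - v((k+1)/n).
   Testing LU = -q U with h_k turns the eigenvalue equation into the recurrence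
   u_{k+1} + u_{k-1} = 2 c u_k, u_0 = u_n = 0, for the grid values of U, where
   c = \<sigma>'(h) - 2 n \<sigma>(h); and if all grid values vanish, testing with U itself gives U = 0. Hence c
   is a root of a Chebyshev polynomial of the second kind. For q = 0 we get c = -1, which is not a
   root. For q = \<kappa>^2 > 0, c = cosh s - 2 sinh s / s with s = \<kappa>/n is strictly increasing in s, so
   there are finitely many negative eigenvalues. Conversely the value c = cos(pi/n) is attained, and
   the combination of the h_k with coefficients sin(k pi/n) is an eigenfunction. *)

theory Submission
  imports Defs "HOL-Computational_Algebra.Polynomial"
begin

subsection \<open>Smooth bump functions\<close>

text \<open>The coupling \<open>4 * n\<close> is critical: for q = 0 it puts c at the endpoint -1 of
  [-1, 1], while all roots of the Chebyshev polynomial lie in the open interval. As s grows from 0,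
  the value c climbs from -1 through every root; \<open>cos (pi / n)\<close> is the largest one and
  is nonnegative, so crude bounds suffice to reach it. Between the nodes each hat solves the same
  equation as U, so the recurrence is exact and not an approximation. The analytic obstacle is
  membership: \<open>H01\<close> is a closure of smooth compactly supported functions, and its weak
  derivative is an arbitrary choice. Hats have a kink, so explicit smooth approximations must be
  built for them. They are built for the derivative, because in one dimension the L2 norm of the
  derivative controls the supremum of the function. This leads to the pairs
  \<open>h01_deriv u D\<close>, where D is explicit and u is its primitive.\<close>

definition flat :: "real poly \<Rightarrow> real \<Rightarrow> real" where
  "flat p t = (if t > 0 then poly p (1 / t) * exp (- (1 / t)) else 0)"

lemma poly_times_exp_minus_tendsto_0: "((\<lambda>y. poly p y * exp (- y)) \<longlongrightarrow> (0::real)) at_top"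
proof -
  have "((\<lambda>y. \<Sum>i\<le>degree p. coeff p i * (y ^ i / exp y)) \<longlongrightarrow> (\<Sum>i\<le>degree p. coeff p i * 0)) at_top"
    by (intro tendsto_sum tendsto_mult tendsto_const tendsto_power_div_exp_0)
  then show ?thesis
    by (simp add: poly_altdef sum_distrib_right exp_minus divide_inverse mult.assoc)
qed

lemma flat_tendsto_0: "(flat p \<longlongrightarrow> 0) (at 0)"
proof -
  have "((\<lambda>t. poly p (inverse t) * exp (- inverse t)) \<longlongrightarrow> 0) (at_right (0::real))"
    using filterlim_compose[OF poly_times_exp_minus_tendsto_0 filterlim_inverse_at_top_right] .
  then have "(flat p \<longlongrightarrow> 0) (at_right 0)"
    by (rule Lim_transform_eventually)
       (auto simp: flat_def inverse_eq_divide eventually_at_right_less intro!: eventually_at_rightI[of 0 1])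
  moreover have "((\<lambda>_. 0) \<longlongrightarrow> (0::real)) (at_left (0::real))"
    by simp
  then have "(flat p \<longlongrightarrow> 0) (at_left 0)"
    by (rule Lim_transform_eventually) (auto simp: flat_def intro!: eventually_at_leftI[of "-1" 0])
  ultimately show ?thesis
    by (simp add: filterlim_split_at)
qed

text \<open>With y = 1/t the derivative of p(y) exp(-y) is y^2 (p(y) - p'(y)) exp(-y), again a
  polynomial in 1/t times the same exponential; this is why \<open>flat\<close> carries an arbitrary
  polynomial. At 0 the difference quotient is the member with polynomial X p, which tends to
  0.\<close>

lemma DERIV_flat: "(flat p has_field_derivative flat ([:0, 0, 1:] * (p - pderiv p)) t) (at t)"
proof -
  consider "t > 0" | "t < 0" | "t = 0" by linarith
  then show ?thesis
  proof cases
    case 1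
    have "((\<lambda>t. poly p (1 / t) * exp (- (1 / t))) has_field_derivative
        flat ([:0, 0, 1:] * (p - pderiv p)) t) (at t)"
      using 1
      by (auto intro!: derivative_eq_intros simp: flat_def field_simps power2_eq_square)
    then show ?thesis
      by (rule has_field_derivative_transform_within_open[of _ _ _ "{0<..}"]) (use 1 in \<open>auto simp: flat_def\<close>)
  next
    case 2
    have "((\<lambda>t. 0) has_field_derivative flat ([:0, 0, 1:] * (p - pderiv p)) t) (at t)"
      using 2 by (auto simp: flat_def)
    then show ?thesis
      by (rule has_field_derivative_transform_within_open[of _ _ _ "{..<0}"]) (use 2 in \<open>auto simp: flat_def\<close>)
  next
    case 3
    have "(\<lambda>y. (flat p y - flat p 0) / (y - 0)) = flat ([:0, 1:] * p)"
      by (auto simp: flat_def fun_eq_iff)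
    then show ?thesis
      using 3 flat_tendsto_0[of "[:0, 1:] * p"] by (simp add: has_field_derivative_iff flat_def)
  qed
qed

text \<open>A class of explicit functions that is closed under differentiation, hence consists of smooth
  functions, and is rich enough to contain bump functions.\<close>

inductive_set elem_smooth :: "(real \<Rightarrow> real) set" where
  const: "(\<lambda>x. c) \<in> elem_smooth"
| exp: "(\<lambda>x. exp (\<alpha> * x + \<beta>)) \<in> elem_smooth"
| flat: "(\<lambda>x. flat p (\<alpha> * x + \<beta>)) \<in> elem_smooth"
| add: "f \<in> elem_smooth \<Longrightarrow> g \<in> elem_smooth \<Longrightarrow> (\<lambda>x. f x + g x) \<in> elem_smooth"
| mult: "f \<in> elem_smooth \<Longrightarrow> g \<in> elem_smooth \<Longrightarrow> (\<lambda>x. f x * g x) \<in> elem_smooth"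

lemma elem_smooth_scale: "f \<in> elem_smooth \<Longrightarrow> (\<lambda>x. c * f x) \<in> elem_smooth"
  by (intro elem_smooth.intros)

lemma elem_smooth_diff:
  "f \<in> elem_smooth \<Longrightarrow> g \<in> elem_smooth \<Longrightarrow> (\<lambda>x. f x - g x) \<in> elem_smooth"
  using elem_smooth.add[OF _ elem_smooth_scale[of g "-1"], of f] by simp

text \<open>The two slopes of a hat are a shifted and a reflected copy of one profile; both are
  affine substitutions.\<close>

lemma elem_smooth_affine: "f \<in> elem_smooth \<Longrightarrow> (\<lambda>x. f (a * x + b)) \<in> elem_smooth"
proof (induction rule: elem_smooth.induct)
  case (exp \<alpha> \<beta>)
  then show ?case
    using elem_smooth.exp[of "\<alpha> * a" "\<alpha> * b + \<beta>"] by (simp add: algebra_simps)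
next
  case (flat p \<alpha> \<beta>)
  then show ?case
    using elem_smooth.flat[of p "\<alpha> * a" "\<alpha> * b + \<beta>"] by (simp add: algebra_simps)
qed (auto intro: elem_smooth.intros)

lemma elem_smooth_derivative:
  "f \<in> elem_smooth \<Longrightarrow> \<exists>g\<in>elem_smooth. \<forall>x. (f has_field_derivative g x) (at x)"
proof (induction rule: elem_smooth.induct)
  case (const c)
  then show ?case by (intro bexI[of _ "\<lambda>x. 0"] elem_smooth.intros) auto
next
  case (exp \<alpha> \<beta>)
  then show ?case
    by (intro bexI[of _ "\<lambda>x. \<alpha> * exp (\<alpha> * x + \<beta>)"] elem_smooth.intros)
       (auto intro!: derivative_eq_intros)
next
  case (flat p \<alpha> \<beta>)
  show ?case
    by (intro bexI[of _ "\<lambda>x. flat ([:0, 0, 1:] * (p - pderiv p)) (\<alpha> * x + \<beta>) * \<alpha>"]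
          elem_smooth.intros allI DERIV_chain2[where f = "flat p"] DERIV_flat)
       (auto intro!: derivative_eq_intros)
next
  case (add f g)
  then obtain f' g' where "f' \<in> elem_smooth" "g' \<in> elem_smooth"
    "\<And>x. (f has_field_derivative f' x) (at x)" "\<And>x. (g has_field_derivative g' x) (at x)" by blast
  then show ?case
    by (intro bexI[of _ "\<lambda>x. f' x + g' x"] elem_smooth.intros) (auto intro!: derivative_eq_intros)
next
  case (mult f g)
  then obtain f' g' where "f' \<in> elem_smooth" "g' \<in> elem_smooth"
    "\<And>x. (f has_field_derivative f' x) (at x)" "\<And>x. (g has_field_derivative g' x) (at x)" by blast
  then show ?case using mult
    by (intro bexI[of _ "\<lambda>x. f x * g' x + f' x * g x"] elem_smooth.intros)
       (auto intro!: derivative_eq_intros)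
qed

lemma elem_smooth_deriv_iterate: "f \<in> elem_smooth \<Longrightarrow> (deriv ^^ k) f \<in> elem_smooth"
proof (induction k arbitrary: f)
  case (Suc k)
  obtain g where g: "g \<in> elem_smooth" "\<And>x. (f has_field_derivative g x) (at x)"
    using elem_smooth_derivative[OF Suc.prems] by blast
  then have "deriv f = g" by (auto intro: DERIV_imp_deriv)
  then show ?case using Suc.IH[OF g(1)] by (simp add: funpow_swap1)
qed simp

lemma elem_smooth_differentiable: "f \<in> elem_smooth \<Longrightarrow> (deriv ^^ k) f differentiable_on UNIV"
  using elem_smooth_derivative[OF elem_smooth_deriv_iterate[of f k]]
  by (auto simp: differentiable_on_def real_differentiable_def)

lemma elem_smooth_continuous: "f \<in> elem_smooth \<Longrightarrow> continuous_on S f"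
  using elem_smooth_derivative[of f] by (meson DERIV_continuous_on has_field_derivative_at_within)

section \<open>Test functions and interior bumps\<close>

lemma test_01D:
  assumes "\<phi> \<in> test_01"
  obtains a b where "0 < a" "b < 1" "\<And>x. x \<notin> {a..b} \<Longrightarrow> \<phi> x = 0"
  using assms unfolding test_01_def by blast

lemma test_01_eq_0: "\<phi> \<in> test_01 \<Longrightarrow> x \<notin> {0<..<1} \<Longrightarrow> \<phi> x = 0"
  by (elim test_01D) auto

lemma test_01_DERIV:
  assumes "\<phi> \<in> test_01" shows "(\<phi> has_field_derivative deriv \<phi> x) (at x)"
proof -
  have "(deriv ^^ 0) \<phi> differentiable_on UNIV" using assms unfolding test_01_def by blast
  then show ?thesis
    by (simp add: differentiable_on_def DERIV_deriv_iff_real_differentiable)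
qed

lemma deriv_test_01:
  assumes "\<phi> \<in> test_01" shows "deriv \<phi> \<in> test_01"
proof -
  have s: "\<And>k. (deriv ^^ Suc k) \<phi> differentiable_on UNIV" using assms unfolding test_01_def by blast
  obtain a b where ab: "0 < a" "b < 1" "\<And>x. x \<notin> {a..b} \<Longrightarrow> \<phi> x = 0"
    using test_01D[OF assms] by blast
  have "deriv \<phi> x = 0" if "x \<notin> {a..b}" for x
  proof (rule DERIV_imp_deriv, rule has_field_derivative_transform_within_open)
    show "((\<lambda>x. 0) has_field_derivative 0) (at x)" by simp
    show "open (- {a..b})" by (simp add: open_Compl)
  qed (use that ab in auto)
  then show ?thesis
    using s[unfolded funpow_Suc_right o_apply] ab(1,2) unfolding test_01_def by blast
qed

lemma test_01_continuous: "\<phi> \<in> test_01 \<Longrightarrow> continuous_on S \<phi>"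
  by (meson DERIV_continuous_on has_field_derivative_at_within test_01_DERIV)

lemma test_01_bounded:
  assumes "\<phi> \<in> test_01" obtains B where "\<And>x. \<bar>\<phi> x\<bar> \<le> B"
proof -
  obtain a b where ab: "\<And>x. x \<notin> {a..b} \<Longrightarrow> \<phi> x = 0"
    using test_01D[OF assms] by blast
  have "bounded (\<phi> ` {a..b})"
    by (intro compact_imp_bounded compact_continuous_image test_01_continuous assms) auto
  then obtain B where B: "\<And>x. x \<in> {a..b} \<Longrightarrow> \<bar>\<phi> x\<bar> \<le> B"
    by (auto simp: bounded_iff simp del: atLeastAtMost_iff)
  have "\<bar>\<phi> x\<bar> \<le> max B 0" for x using B[of x] ab[of x] by (cases "x \<in> {a..b}") auto
  then show ?thesis by (rule that)
qed

lemma deriv_iterate_add_scale: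
  assumes "\<phi> \<in> test_01" "\<psi> \<in> test_01"
  shows "(deriv ^^ k) (\<lambda>x. c * \<phi> x + d * \<psi> x) = (\<lambda>x. c * (deriv ^^ k) \<phi> x + d * (deriv ^^ k) \<psi> x)"
proof (induction k)
  case (Suc k)
  have "(deriv ^^ k) \<phi> \<in> test_01" "(deriv ^^ k) \<psi> \<in> test_01"
    using assms by (induction k) (auto intro: deriv_test_01)
  then show ?case unfolding funpow.simps o_apply Suc
    by (intro ext DERIV_imp_deriv) (auto intro!: derivative_eq_intros test_01_DERIV)
qed simp

lemma test_01_lincomb:
  assumes "\<phi> \<in> test_01" "\<psi> \<in> test_01"
  shows "(\<lambda>x. c * \<phi> x + d * \<psi> x) \<in> test_01"
proof -
  obtain a b where ab: "0 < a" "b < 1" "\<And>x. x \<notin> {a..b} \<Longrightarrow> \<phi> x = 0"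
    using test_01D[OF assms(1)] by blast
  obtain a' b' where ab': "0 < a'" "b' < 1" "\<And>x. x \<notin> {a'..b'} \<Longrightarrow> \<psi> x = 0"
    using test_01D[OF assms(2)] by blast
  have "c * \<phi> x + d * \<psi> x = 0" if "x \<notin> {min a a'..max b b'}" for x
  proof -
    have "x \<notin> {a..b}" "x \<notin> {a'..b'}" using that by auto
    then show ?thesis using ab(3) ab'(3) by simp
  qed
  then have "\<exists>a b. 0 < a \<and> b < 1 \<and> (\<forall>x. x \<notin> {a..b} \<longrightarrow> c * \<phi> x + d * \<psi> x = 0)"
    using ab ab' by (intro exI[of _ "min a a'"] exI[of _ "max b b'"]) auto
  moreover have "\<And>k. (deriv ^^ k) \<phi> differentiable_on UNIV" "\<And>k. (deriv ^^ k) \<psi> differentiable_on UNIV"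
    using assms unfolding test_01_def by blast+
  ultimately show ?thesis
    unfolding test_01_def mem_Collect_eq deriv_iterate_add_scale[OF assms]
    by (intro conjI allI) (auto intro!: derivative_intros)
qed

lemma elem_smooth_test_01:
  assumes "f \<in> elem_smooth" "0 < a" "b < 1" "\<And>x. x \<notin> {a..b} \<Longrightarrow> f x = 0"
  shows "f \<in> test_01"
  using assms elem_smooth_differentiable unfolding test_01_def by blast

text \<open>A smooth approximation of the indicator of (a, b) from inside. The shift by 1 keeps the
  support at distance 1/m from the endpoints, so that a bump over a subinterval of [0, 1] has
  compact support in (0, 1); the slope m drives each factor to 1 at every interior point.\<close>

definition bump :: "real \<Rightarrow> real \<Rightarrow> nat \<Rightarrow> real \<Rightarrow> real" where
  "bump a b m x = flat 1 (real m * (x - a) - 1) * flat 1 (real m * (b - x) - 1)"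

lemma bump_elem_smooth: "bump a b m \<in> elem_smooth"
proof -
  have "(\<lambda>x. flat 1 (real m * x + (- real m * a - 1)) * flat 1 (- real m * x + (real m * b - 1))) \<in> elem_smooth"
    by (intro elem_smooth.intros)
  then show ?thesis by (simp add: bump_def[abs_def] algebra_simps)
qed

lemma flat_1_bounds: "0 \<le> flat 1 t" "flat 1 t \<le> 1"
  by (auto simp: flat_def)

lemma bump_bounds: "0 \<le> bump a b m x" "bump a b m x \<le> 1"
  by (auto simp: bump_def flat_1_bounds mult_le_one)

lemma bump_eq_0:
  assumes "m > 0" "x \<notin> {a + 1 / m..b - 1 / m}" shows "bump a b m x = 0"
  using assms by (auto simp: bump_def flat_def field_simps)

lemma flat_1_tendsto:
  assumes "s > 0" shows "(\<lambda>m. flat 1 (real m * s - 1)) \<longlonglongrightarrow> 1"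
proof -
  have *: "filterlim (\<lambda>m. real m * s - 1) at_top sequentially"
    using assms by real_asymp
  have "(\<lambda>m. exp (- inverse (real m * s - 1))) \<longlonglongrightarrow> exp (- 0)"
    by (intro tendsto_intros tendsto_inverse_0_at_top *)
  moreover have "\<forall>\<^sub>F m in sequentially. real m * s - 1 > 0"
    using filterlim_at_top_dense[THEN iffD1, OF *] by blast
  ultimately show ?thesis
    by (auto elim!: Lim_transform_eventually eventually_mono simp: flat_def inverse_eq_divide)
qed

lemma bump_tendsto: "(\<lambda>m. bump a b m x) \<longlonglongrightarrow> indicator {a<..<b} x"
proof (cases "x \<in> {a<..<b}")
  case True
  then have "(\<lambda>m. bump a b m x) \<longlonglongrightarrow> 1 * 1"
    unfolding bump_def by (intro tendsto_mult flat_1_tendsto) auto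
  then show ?thesis using True by simp
next
  case False
  have "bump a b m x = 0" for m
  proof -
    \<comment> \<open>One factor has an argument of at most -1, so the product is zero for every
      m.\<close>
    have "real m * (x - a) \<le> 0 \<or> real m * (b - x) \<le> 0"
      using False by (auto simp: mult_le_0_iff)
    then show ?thesis by (auto simp: bump_def flat_def)
  qed
  then show ?thesis using False by simp
qed

lemma bump_test_01:
  assumes "0 \<le> a" "b \<le> 1" "m > 0" shows "bump a b m \<in> test_01"
proof (rule elem_smooth_test_01[OF bump_elem_smooth])
  have "1 / real m > 0" using assms by simp
  then show "0 < a + 1 / m" "b - 1 / m < 1" using assms by linarith+
  show "\<And>x. x \<notin> {a + 1 / m..b - 1 / m} \<Longrightarrow> bump a b m x = 0"
    using bump_eq_0 assms by auto
qed

subsection \<open>Square-integrable functions and the fundamental lemma\<close>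

definition sqint :: "(real \<Rightarrow> real) \<Rightarrow> real" where
  "sqint f = (LINT x|leb01. (f x)\<^sup>2)"

lemma emeasure_leb01: "emeasure leb01 (space leb01) = 1"
  by (simp add: emeasure_restrict_space)

lemma measure_leb01: "measure leb01 {0<..<1} = 1"
  by (simp add: measure_restrict_space)

lemma finite_measure_leb01: "finite_measure leb01"
  by (rule finite_measureI) (simp add: emeasure_leb01[simplified])

lemma borel_measurable_leb01:
  fixes f :: "real \<Rightarrow> real"
  assumes "f \<in> borel_measurable borel"
  shows "f \<in> borel_measurable leb01"
proof -
  have "f \<in> borel_measurable lebesgue" using assms by (simp add: measurable_completion)
  then show ?thesis by (rule measurable_restrict_space1)
qed

lemma integrable_leb01_bounded:
  fixes f :: "real \<Rightarrow> real"
  assumes "f \<in> borel_measurable leb01" "\<And>x. x \<in> {0<..<1} \<Longrightarrow> \<bar>f x\<bar> \<le> B"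
  shows "integrable leb01 f"
  by (rule finite_measure.integrable_const_bound[OF finite_measure_leb01, where B = B])
     (use assms in \<open>auto intro!: AE_I2\<close>)

lemma L2_01_bounded:
  assumes "f \<in> borel_measurable leb01" "\<And>x. x \<in> {0<..<1} \<Longrightarrow> \<bar>f x\<bar> \<le> B"
  shows "f \<in> L2_01"
proof -
  have "\<bar>(f x)\<^sup>2\<bar> \<le> B\<^sup>2" if "x \<in> {0<..<1}" for x
    using power_mono[OF assms(2)[OF that], of 2] by simp
  then have "integrable leb01 (\<lambda>x. (f x)\<^sup>2)"
    using assms(1) by (intro integrable_leb01_bounded[where B = "B\<^sup>2"]) auto
  then show ?thesis using assms(1) by (simp add: L2_01_def)
qed

lemma L2_01_measurable: "f \<in> L2_01 \<Longrightarrow> f \<in> borel_measurable leb01"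
  by (simp add: L2_01_def)

lemma L2_01_mult_integrable:
  assumes "f \<in> L2_01" "g \<in> L2_01" shows "integrable leb01 (\<lambda>x. f x * g x)"
proof (rule Bochner_Integration.integrable_bound)
  show "integrable leb01 (\<lambda>x. (f x)\<^sup>2 + (g x)\<^sup>2)" using assms by (auto simp: L2_01_def)
  show "(\<lambda>x. f x * g x) \<in> borel_measurable leb01" using assms by (auto simp: L2_01_def)
  show "AE x in leb01. norm (f x * g x) \<le> norm ((f x)\<^sup>2 + (g x)\<^sup>2)"
  proof (rule AE_I2)
    fix x
    have "2 * \<bar>f x\<bar> * \<bar>g x\<bar> \<le> (f x)\<^sup>2 + (g x)\<^sup>2"
      using sum_squares_bound[of "\<bar>f x\<bar>" "\<bar>g x\<bar>"] by simp
    moreover have "0 \<le> \<bar>f x\<bar> * \<bar>g x\<bar>" by simp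
    ultimately show "norm (f x * g x) \<le> norm ((f x)\<^sup>2 + (g x)\<^sup>2)" unfolding real_norm_def abs_mult by linarith
  qed
qed

lemma L2_01_const: "(\<lambda>x. c) \<in> L2_01"
  by (rule L2_01_bounded[where B = "\<bar>c\<bar>"]) auto

lemma L2_01_integrable: "f \<in> L2_01 \<Longrightarrow> integrable leb01 f"
  using L2_01_mult_integrable[OF _ L2_01_const[of 1]] by simp

lemma L2_01_add: assumes "f \<in> L2_01" "g \<in> L2_01" shows "(\<lambda>x. f x + g x) \<in> L2_01"
proof -
  have "integrable leb01 (\<lambda>x. (f x)\<^sup>2 + (g x)\<^sup>2 + 2 * (f x * g x))"
    using L2_01_mult_integrable[OF assms] assms by (auto simp: L2_01_def)
  then show ?thesis using assms by (auto simp: L2_01_def power2_sum mult.assoc)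
qed

lemma L2_01_scale: "f \<in> L2_01 \<Longrightarrow> (\<lambda>x. c * f x) \<in> L2_01"
  by (auto simp: L2_01_def power_mult_distrib)

lemma L2_01_diff: "f \<in> L2_01 \<Longrightarrow> g \<in> L2_01 \<Longrightarrow> (\<lambda>x. f x - g x) \<in> L2_01"
  using L2_01_add[of f "\<lambda>x. -1 * g x"] L2_01_scale[of g "-1"] by simp

lemma L2_01_indicator_mult:
  assumes "f \<in> L2_01" "A \<in> sets borel" shows "(\<lambda>x. indicator A x * f x) \<in> L2_01"
proof -
  have [measurable]: "f \<in> borel_measurable leb01" using assms by (simp add: L2_01_def)
  have [measurable]: "(indicator A :: real \<Rightarrow> real) \<in> borel_measurable leb01"
    using assms by (intro borel_measurable_leb01) simp
  have [measurable]: "(\<lambda>x. indicator A x * f x) \<in> borel_measurable leb01" by (intro borel_measurable_times) measurable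
  have "integrable leb01 (\<lambda>x. (indicator A x * f x)\<^sup>2)"
    by (rule Bochner_Integration.integrable_bound[of _ "\<lambda>x. (f x)\<^sup>2"])
       (use assms in \<open>auto simp: L2_01_def power_mult_distrib split: split_indicator\<close>)
  then show ?thesis by (simp add: L2_01_def)
qed

lemma sqint_nonneg: "0 \<le> sqint f"
  unfolding sqint_def by (rule integral_nonneg_AE) simp

text \<open>The squared norm of f + t g is a nonnegative quadratic in t, which bounds its
  discriminant.\<close>

lemma L2_01_Cauchy_Schwarz:
  assumes f: "f \<in> L2_01" and g: "g \<in> L2_01"
  shows "\<bar>LINT x|leb01. f x * g x\<bar> \<le> sqrt (sqint f) * sqrt (sqint g)"
proof -
  define A B C where "A = sqint f" and "B = sqint g" and "C = (LINT x|leb01. f x * g x)"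
  have quad: "0 \<le> A + 2 * t * C + t\<^sup>2 * B" for t
  proof -
    have "sqint (\<lambda>x. f x + t * g x) = (LINT x|leb01. (f x)\<^sup>2 + 2 * t * (f x * g x) + t\<^sup>2 * (g x)\<^sup>2)"
      unfolding sqint_def by (rule Bochner_Integration.integral_cong) (auto simp: power2_eq_square algebra_simps)
    also have "\<dots> = A + 2 * t * C + t\<^sup>2 * B"
      using L2_01_mult_integrable[OF f g] f g by (simp add: L2_01_def A_def B_def C_def sqint_def)
    finally show ?thesis using sqint_nonneg[of "\<lambda>x. f x + t * g x"] by simp
  qed
  have "C\<^sup>2 \<le> A * B"
  proof (cases "B = 0")
    case True
    have "C = 0"
    proof (rule ccontr)
      assume "C \<noteq> 0"
      \<comment> \<open>For B = 0 the quadratic is linear, and at this t it takes the value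
        -1.\<close>
      then show False using quad[of "- (A + 1) / (2 * C)"] True by (simp add: field_simps)
    qed
    then show ?thesis using True by simp
  next
    case False
    then have "B > 0" using sqint_nonneg[of g] by (simp add: B_def less_le)
    \<comment> \<open>The minimiser of the quadratic.\<close>
    then show ?thesis using quad[of "- C / B"] by (simp add: field_simps power2_eq_square)
  qed
  then have "\<bar>C\<bar> \<le> sqrt (A * B)" by (metis real_sqrt_abs real_sqrt_le_mono)
  then show ?thesis by (simp add: A_def B_def C_def real_sqrt_mult)
qed

lemma sqint_tendsto_integral:
  assumes "f \<in> L2_01" "g \<in> L2_01" "\<And>j. F j \<in> L2_01" "(\<lambda>j. sqint (\<lambda>x. f x - F j x)) \<longlonglongrightarrow> 0"
  shows "(\<lambda>j. LINT x|leb01. F j x * g x) \<longlonglongrightarrow> (LINT x|leb01. f x * g x)"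
proof -
  have *: "\<bar>(LINT x|leb01. F j x * g x) - (LINT x|leb01. f x * g x)\<bar>
      \<le> sqrt (sqint (\<lambda>x. f x - F j x)) * sqrt (sqint g)" for j
  proof -
    have "(LINT x|leb01. f x * g x) - (LINT x|leb01. F j x * g x) = (LINT x|leb01. (f x - F j x) * g x)"
      by (simp add: L2_01_mult_integrable assms left_diff_distrib)
    then show ?thesis
      using L2_01_Cauchy_Schwarz[OF L2_01_diff[OF assms(1) assms(3)[of j]] assms(2)] by (simp add: abs_minus_commute)
  qed
  have "(\<lambda>j. sqrt (sqint (\<lambda>x. f x - F j x)) * sqrt (sqint g)) \<longlonglongrightarrow> 0"
    using tendsto_real_sqrt[OF assms(4)] by (intro tendsto_mult_left_zero) simp
  then have "(\<lambda>j. (LINT x|leb01. F j x * g x) - (LINT x|leb01. f x * g x)) \<longlonglongrightarrow> 0"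
    by (rule Lim_null_comparison[rotated]) (intro always_eventually allI, unfold real_norm_def, rule *)
  then show ?thesis by (rule LIM_zero_cancel)
qed

text \<open>The inequality (a + b)^2 \<le> 2 a^2 + 2 b^2 stands in for the triangle inequality, so
  that squared norms suffice.\<close>

lemma sqint_sum_tendsto_0:
  assumes "\<And>j. F j \<in> L2_01" "\<And>j. G j \<in> L2_01" "(\<lambda>j. sqint (F j)) \<longlonglongrightarrow> 0" "(\<lambda>j. sqint (G j)) \<longlonglongrightarrow> 0"
  shows "(\<lambda>j. sqint (\<lambda>x. F j x + G j x)) \<longlonglongrightarrow> 0"
proof (rule Lim_null_comparison)
  show "(\<lambda>j. 2 * sqint (F j) + 2 * sqint (G j)) \<longlonglongrightarrow> 0"
    by (intro tendsto_add_zero tendsto_mult_right_zero assms)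
  have "sqint (\<lambda>x. F j x + G j x) \<le> 2 * sqint (F j) + 2 * sqint (G j)" for j
  proof -
    have *: "(F j x + G j x)\<^sup>2 \<le> 2 * (F j x)\<^sup>2 + 2 * (G j x)\<^sup>2" for x
      using sum_squares_bound[of "F j x" "G j x"] by (simp add: power2_sum)
    have "sqint (\<lambda>x. F j x + G j x) \<le> (LINT x|leb01. 2 * (F j x)\<^sup>2 + 2 * (G j x)\<^sup>2)"
      unfolding sqint_def
    proof (rule integral_mono)
      show "integrable leb01 (\<lambda>x. (F j x + G j x)\<^sup>2)"
        using L2_01_add[OF assms(1,2)[of j]] by (simp add: L2_01_def)
      show "integrable leb01 (\<lambda>x. 2 * (F j x)\<^sup>2 + 2 * (G j x)\<^sup>2)"
        using assms(1,2)[of j] by (simp add: L2_01_def)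
    qed (rule *)
    also have "\<dots> = 2 * sqint (F j) + 2 * sqint (G j)"
      using assms(1,2)[of j] by (simp add: L2_01_def sqint_def)
    finally show ?thesis .
  qed
  then show "\<forall>\<^sub>F j in sequentially. norm (sqint (\<lambda>x. F j x + G j x)) \<le> 2 * sqint (F j) + 2 * sqint (G j)"
    by (simp add: sqint_nonneg)
qed

lemma test_01_L2_01:
  assumes "\<phi> \<in> test_01" shows "\<phi> \<in> L2_01"
proof -
  obtain B where "\<And>x. \<bar>\<phi> x\<bar> \<le> B" using test_01_bounded[OF assms] by blast
  then show ?thesis
    using borel_measurable_leb01[OF borel_measurable_continuous_onI[OF test_01_continuous[OF assms]]]
    by (intro L2_01_bounded[where B = B])
qed

text \<open>The fundamental theorem of calculus, carried from closed intervals and Borel measure to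
  the restricted Lebesgue measure: endpoints are null, completion keeps the integrals of Borel
  functions, and an interval inside [0, 1] loses nothing under the restriction.\<close>

lemma has_bochner_integral_leb01:
  fixes f :: "real \<Rightarrow> real"
  assumes "0 \<le> a" "a \<le> b" "b \<le> 1" "\<And>x. (F has_field_derivative f x) (at x)" "continuous_on UNIV f"
  shows "has_bochner_integral leb01 (\<lambda>x. indicator {a<..<b} x * f x) (F b - F a)"
proof -
  have [measurable]: "f \<in> borel_measurable borel" using assms(5) by (rule borel_measurable_continuous_onI)
  have eq: "indicator {0<..<1} x *\<^sub>R (indicator {a<..<b} x * f x) = indicator {a<..<b} x * f x" for x
    using assms by (auto simp: indicator_def)
  note eq' = eq[simplified real_scaleR_def]
  have "set_integrable lborel {a..b} f"
    by (intro borel_integrable_atLeastAtMost' continuous_on_subset[OF assms(5)]) auto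
  then have "integrable lborel (\<lambda>x. indicator {a..b} x * f x)" by (simp add: set_integrable_def)
  moreover have ae: "AE x in lborel. indicator {a..b} x * f x = indicator {a<..<b} x * f x"
    using AE_lborel_singleton[of a] AE_lborel_singleton[of b] by eventually_elim (auto simp: indicator_def)
  ultimately have i: "integrable lborel (\<lambda>x. indicator {a<..<b} x * f x)"
    by (subst (asm) integrable_cong_AE) auto
  then have "integrable leb01 (\<lambda>x. indicator {a<..<b} x * f x)"
    by (subst integrable_restrict_space) (simp_all add: eq' integrable_completion)
  moreover have "(LINT x|leb01. indicator {a<..<b} x * f x) = F b - F a"
  proof -
    have "(LINT x|leb01. indicator {a<..<b} x * f x) = (LINT x|lborel. indicator {a<..<b} x * f x)"
    by (subst integral_restrict_space) (simp_all add: eq' integral_completion)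
  also have "\<dots> = (LINT x|lborel. indicator {a..b} x * f x)"
    using ae by (intro integral_cong_AE) (auto elim!: eventually_mono)
  also have "\<dots> = F b - F a"
    using integral_FTC_atLeastAtMost[of a b F f] assms continuous_on_subset[OF assms(5), of "{a..b}"]
    by (auto intro: has_field_derivative_at_within simp flip: has_real_derivative_iff_has_vector_derivative)
  finally show ?thesis .
  qed
  ultimately show ?thesis by (simp add: has_bochner_integral_iff)
qed

lemmas integral_leb01_FTC = has_bochner_integral_leb01[THEN has_bochner_integral_integral_eq]

lemma integral_leb01_cong:
  "(\<And>x. x \<in> {0<..<1} \<Longrightarrow> f x = g x) \<Longrightarrow> (LINT x|leb01. f x) = (LINT x|leb01. g x :: real)"
  by (rule Bochner_Integration.integral_cong) auto

lemma integral_deriv_test_01: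
  assumes "\<phi> \<in> test_01" "0 \<le> x" "x \<le> 1"
  shows "(LINT t|leb01. indicator {0<..<x} t * deriv \<phi> t) = \<phi> x"
  using integral_leb01_FTC[OF _ assms(2,3) test_01_DERIV[OF assms(1)] test_01_continuous[OF deriv_test_01[OF assms(1)]]]
    test_01_eq_0[OF assms(1), of 0] by simp

lemma integral_by_parts_test_01:
  assumes "\<phi> \<in> test_01" "\<psi> \<in> test_01"
  shows "(LINT x|leb01. \<phi> x * deriv \<psi> x) = - (LINT x|leb01. deriv \<phi> x * \<psi> x)"
proof -
  note L2 = assms[THEN test_01_L2_01] assms[THEN deriv_test_01, THEN test_01_L2_01]
  have "(LINT x|leb01. indicator {0<..<1} x * (\<phi> x * deriv \<psi> x + deriv \<phi> x * \<psi> x)) = \<phi> 1 * \<psi> 1 - \<phi> 0 * \<psi> 0"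
    by (rule integral_leb01_FTC)
       (auto intro!: derivative_eq_intros test_01_DERIV assms continuous_on_add continuous_on_mult
          intro: test_01_continuous deriv_test_01)
  also have "(LINT x|leb01. indicator {0<..<1} x * (\<phi> x * deriv \<psi> x + deriv \<phi> x * \<psi> x)) =
     (LINT x|leb01. \<phi> x * deriv \<psi> x + deriv \<phi> x * \<psi> x)"
    by (rule integral_leb01_cong) simp
  also have "\<dots> = (LINT x|leb01. \<phi> x * deriv \<psi> x) + (LINT x|leb01. deriv \<phi> x * \<psi> x)"
    by (rule Bochner_Integration.integral_add) (rule L2_01_mult_integrable L2)+
  finally show ?thesis using test_01_eq_0[OF assms(1)] by simp
qed

lemma integral_bump_tendsto:
  assumes "f \<in> L2_01"
  shows "(\<lambda>m. LINT x|leb01. bump a b (Suc m) x * f x) \<longlonglongrightarrow> (LINT x|leb01. indicator {a<..<b} x * f x)"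
proof -
  have fm: "f \<in> borel_measurable leb01" and fi: "integrable leb01 f"
    using assms by (auto simp: L2_01_measurable L2_01_integrable)
  show ?thesis
  proof (rule integral_dominated_convergence)
    show "integrable leb01 (\<lambda>x. \<bar>f x\<bar>)" using fi by simp
    show "AE x in leb01. (\<lambda>m. bump a b (Suc m) x * f x) \<longlonglongrightarrow> indicator {a<..<b} x * f x"
      by (intro AE_I2 tendsto_intros LIMSEQ_Suc bump_tendsto)
    show "AE x in leb01. norm (bump a b (Suc m) x * f x) \<le> \<bar>f x\<bar>" for m
      using bump_bounds by (intro AE_I2) (auto simp: abs_mult mult_left_le_one_le)
    show "(\<lambda>x. bump a b (Suc m) x * f x) \<in> borel_measurable leb01" for m
      using borel_measurable_leb01[OF borel_measurable_continuous_onI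
          [OF elem_smooth_continuous[OF bump_elem_smooth]]]
      by (intro borel_measurable_times fm) auto
    show "(\<lambda>x. indicator {a<..<b} x * f x) \<in> borel_measurable leb01"
      by (intro borel_measurable_times fm borel_measurable_leb01[OF borel_measurable_indicator]) simp
  qed
qed

text \<open>Bumps tend to indicators, so the integral of \<open>f\<close> over every open interval
  vanishes. Open intervals are stable under intersection and generate the Borel sets, so it vanishes
  over every Borel set, and uniqueness of densities gives \<open>f\<close> = 0.\<close>

lemma fundamental_lemma_variations:
  assumes f: "f \<in> L2_01" and orth: "\<And>\<phi>. \<phi> \<in> test_01 \<Longrightarrow> (LINT x|leb01. f x * \<phi> x) = 0"
  shows "AE x in leb01. f x = 0"
proof -
  have fi: "integrable leb01 f" by (rule L2_01_integrable[OF f])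
  have intv: "(LINT x|leb01. indicator {a<..<b} x * f x) = 0" for a b
  proof -
    \<comment> \<open>Clipping to [0, 1] makes the bumps test functions and changes nothing inside
      (0, 1).\<close>
    define a' b' where "a' = max 0 a" and "b' = min 1 b"
    have "(\<lambda>m. LINT x|leb01. bump a' b' (Suc m) x * f x) \<longlonglongrightarrow> (LINT x|leb01. indicator {a'<..<b'} x * f x)"
      by (rule integral_bump_tendsto[OF f])
    moreover have "(LINT x|leb01. bump a' b' (Suc m) x * f x) = 0" for m
      using orth[OF bump_test_01[of a' b' "Suc m"]] by (simp add: a'_def b'_def mult.commute)
    moreover have "(LINT x|leb01. indicator {a'<..<b'} x * f x) = (LINT x|leb01. indicator {a<..<b} x * f x)"
      by (rule integral_leb01_cong) (auto simp: indicator_def a'_def b'_def)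
    ultimately show ?thesis by (simp add: LIMSEQ_const_iff)
  qed
  define F where "F = (\<lambda>x. indicator {0<..<1} x * f x)"
  have Fi: "integrable lebesgue F"
    using fi by (subst (asm) integrable_restrict_space) (auto simp: F_def)
  \<comment> \<open>\<open>f\<close> is only Lebesgue measurable, so the argument runs on a Borel
    representative of its extension by zero.\<close>
  obtain G where G: "G \<in> borel_measurable lborel" "AE x in lborel. F x = G x"
    using completion_ex_borel_measurable_real[OF borel_measurable_integrable[OF Fi]] by blast
  then have [measurable]: "G \<in> borel_measurable borel" by simp
  have ae: "AE x in lebesgue. F x = G x" using G(2) by (rule AE_completion)
  have "integrable lebesgue G"
    using integrable_cong_AE[OF borel_measurable_integrable[OF Fi] measurable_completion[OF G(1)] ae] Fi
    by simp
  then have Gi: "integrable lborel G" using G(1) by (simp add: integrable_completion)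
  have Gintv: "(LINT x|lborel. indicator {a<..<b} x * G x) = 0" for a b
  proof -
    have "(LINT x|lborel. indicator {a<..<b} x * G x) = (LINT x|lebesgue. indicator {a<..<b} x * G x)"
      by (rule integral_completion[symmetric]) simp
    also have "\<dots> = (LINT x|lebesgue. indicator {0<..<1} x *\<^sub>R (indicator {a<..<b} x * f x))"
    proof (rule integral_cong_AE)
      show "AE x in lebesgue. indicator {a<..<b} x * G x = indicator {0<..<1} x *\<^sub>R (indicator {a<..<b} x * f x)"
        using ae by eventually_elim (auto simp: F_def)
      have "(\<lambda>x. indicator {a<..<b} x * F x) \<in> borel_measurable lebesgue"
        by (intro borel_measurable_times borel_measurable_integrable[OF Fi] measurable_completion) simp
      then show "(\<lambda>x. indicator {0<..<1} x *\<^sub>R (indicator {a<..<b} x * f x)) \<in> borel_measurable lebesgue"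
        by (simp add: F_def mult.left_commute)
      show "(\<lambda>x. indicator {a<..<b} x * G x) \<in> borel_measurable lebesgue"
        by (intro measurable_completion borel_measurable_times) auto
    qed
    also have "\<dots> = (LINT x|leb01. indicator {a<..<b} x * f x)"
      by (rule integral_restrict_space[symmetric]) auto
    finally show ?thesis using intv by simp
  qed
  have Gi': "integrable lborel (\<lambda>x. indicator A x * G x)" if "A \<in> sets borel" for A
    using integrable_mult_indicator[OF _ Gi, of A] that by simp
  \<comment> \<open>The whole line enters in the complement step of the induction below.\<close>
  have Guniv: "(LINT x|lborel. G x) = 0"
  proof -
    have "(LINT x|lborel. G x) = (LINT x|lebesgue. G x)" by (rule integral_completion[symmetric]) simp
    also have "\<dots> = (LINT x|lebesgue. F x)"
      using ae by (intro integral_cong_AE borel_measurable_integrable[OF Fi] measurable_completion[OF G(1)])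
        (auto elim: eventually_mono)
    also have "\<dots> = (LINT x|leb01. f x)"
      unfolding F_def by (subst integral_restrict_space) auto
    also have "\<dots> = (LINT x|leb01. indicator {0<..<1} x * f x)" by (rule integral_leb01_cong) simp
    finally show ?thesis using intv by simp
  qed
  have zero: "(LINT x|lborel. indicator A x * G x) = 0" if "A \<in> sets borel" for A
  proof -
    let ?E = "range (\<lambda>(a, b). {a<..<b::real})"
    have borel: "sets borel = sigma_sets UNIV ?E"
      by (subst borel_eq_box) (simp add: box_real[abs_def])
    have "Int_stable ?E" by (auto simp: Int_stable_def)
    moreover have "?E \<subseteq> Pow UNIV" by simp
    moreover have "A \<in> sigma_sets UNIV ?E" using that borel by simp
    ultimately show ?thesis
    proof (induction rule: sigma_sets_induct_disjoint)
      case (compl A)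
      then have A: "A \<in> sets borel" by (simp add: borel)
      have "(LINT x|lborel. indicator (UNIV - A) x * G x) = (LINT x|lborel. G x - indicator A x * G x)"
        by (intro Bochner_Integration.integral_cong) (auto simp: indicator_def)
      then show ?case using compl A Gi' Gi Guniv by simp
    next
      case (union A)
      then have A: "\<And>i. A i \<in> sets borel" by (auto simp: borel)
      have "set_integrable lborel (\<Union>i. A i) G" using Gi'[of "\<Union>i. A i"] A by (auto simp: set_integrable_def)
      then have "(LINT x:(\<Union>i. A i)|lborel. G x) = (\<Sum>i. (LINT x:(A i)|lborel. G x))"
        using A union(1) by (intro lebesgue_integral_countable_add) (auto simp: disjoint_family_on_def)
      then show ?case using union(3) by (simp add: set_lebesgue_integral_def)
    qed (use Gintv in auto)
  qed
  have "AE x in lborel. G x = 0"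
    using zero by (intro density_unique_real Gi) (auto simp: set_lebesgue_integral_def)
  then have "AE x in lebesgue. F x = 0"
    using ae AE_completion[of "\<lambda>x. G x = 0" lborel] by (auto elim: eventually_elim2)
  then show ?thesis
    by (subst AE_restrict_space_iff) (auto simp: F_def elim!: eventually_mono)
qed

text \<open>This makes the choice in \<open>weak_deriv\<close> harmless: two candidates differ by a
  function orthogonal to all test functions.\<close>

lemma has_weak_deriv_unique:
  assumes "g \<in> L2_01" "g' \<in> L2_01" "has_weak_deriv u g" "has_weak_deriv u g'"
  shows "AE x in leb01. g x = g' x"
proof -
  have "AE x in leb01. g x - g' x = 0"
  proof (rule fundamental_lemma_variations)
    fix \<phi> assume \<phi>: "\<phi> \<in> test_01"
    then have "(LINT x|leb01. g x * \<phi> x) = (LINT x|leb01. g' x * \<phi> x)"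
      using bspec[OF assms(3)[unfolded has_weak_deriv_def] \<phi>] bspec[OF assms(4)[unfolded has_weak_deriv_def] \<phi>]
      by linarith
    then show "(LINT x|leb01. (g x - g' x) * \<phi> x) = 0"
      using assms \<phi> by (simp add: left_diff_distrib L2_01_mult_integrable test_01_L2_01)
  qed (rule L2_01_diff[OF assms(1,2)])
  then show ?thesis by simp
qed

subsection \<open>Elements of H01 as primitives\<close>

lemma sqint_cong_AE:
  assumes "f \<in> borel_measurable leb01" "g \<in> borel_measurable leb01" "AE x in leb01. f x = g x"
  shows "sqint f = sqint g"
  unfolding sqint_def using assms(3) by (intro integral_cong_AE) (use assms(1,2) in \<open>auto elim: eventually_mono\<close>)

lemma sqint_mono:
  assumes "f \<in> L2_01" "g \<in> L2_01" "\<And>x. x \<in> {0<..<1} \<Longrightarrow> \<bar>f x\<bar> \<le> \<bar>g x\<bar>"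
  shows "sqint f \<le> sqint g"
  unfolding sqint_def
  by (rule integral_mono) (use assms in \<open>auto simp: L2_01_def abs_le_square_iff\<close>)

lemma sqint_const: "sqint (\<lambda>x. c) = c\<^sup>2"
  by (simp add: sqint_def measure_leb01)

lemma sqint_le_bound:
  assumes "f \<in> L2_01" "\<And>x. x \<in> {0<..<1} \<Longrightarrow> \<bar>f x\<bar> \<le> B"
  shows "sqint f \<le> B\<^sup>2"
  using sqint_mono[OF assms(1) L2_01_const[of B]] assms(2) unfolding sqint_const by fastforce

lemma has_weak_deriv_test_01:
  assumes "\<phi> \<in> test_01" shows "has_weak_deriv \<phi> (deriv \<phi>)"
  unfolding has_weak_deriv_def using integral_by_parts_test_01[OF assms] by blast

lemma has_weak_deriv_lincomb:
  assumes "u \<in> L2_01" "v \<in> L2_01" "g \<in> L2_01" "h \<in> L2_01" "has_weak_deriv u g" "has_weak_deriv v h"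
  shows "has_weak_deriv (\<lambda>x. c * u x + d * v x) (\<lambda>x. c * g x + d * h x)"
  unfolding has_weak_deriv_def
proof
  fix \<phi> assume \<phi>: "\<phi> \<in> test_01"
  then have L2: "\<phi> \<in> L2_01" "deriv \<phi> \<in> L2_01"
    by (auto intro: test_01_L2_01 deriv_test_01)
  have lin: "(LINT x|leb01. (c * f x + d * f' x) * k x) = c * (LINT x|leb01. f x * k x) + d * (LINT x|leb01. f' x * k x)"
    if "f \<in> L2_01" "f' \<in> L2_01" "k \<in> L2_01" for f f' k
    using L2_01_mult_integrable[OF that(1,3)] L2_01_mult_integrable[OF that(2,3)]
    by (simp add: distrib_right mult.assoc)
  show "(LINT x|leb01. (c * u x + d * v x) * deriv \<phi> x) = - (LINT x|leb01. (c * g x + d * h x) * \<phi> x)"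
    unfolding lin[OF assms(1,2) L2(2)] lin[OF assms(3,4) L2(1)]
    using bspec[OF assms(5)[unfolded has_weak_deriv_def] \<phi>] bspec[OF assms(6)[unfolded has_weak_deriv_def] \<phi>]
    by simp
qed

lemma weak_deriv_works:
  assumes "g \<in> L2_01" "has_weak_deriv u g"
  shows "weak_deriv u \<in> L2_01" "has_weak_deriv u (weak_deriv u)"
  using someI[of "\<lambda>g. g \<in> L2_01 \<and> has_weak_deriv u g" g] assms unfolding weak_deriv_def by blast+

lemma weak_deriv_AE:
  assumes "g \<in> L2_01" "has_weak_deriv u g"
  shows "AE x in leb01. weak_deriv u x = g x"
  using has_weak_deriv_unique[OF _ assms(1) _ assms(2)] weak_deriv_works[OF assms] by blast

lemma H1_norm_eq:
  assumes "g \<in> L2_01" "has_weak_deriv u g"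
  shows "H1_norm u = sqrt (sqint u + sqint g)"
  using sqint_cong_AE[OF _ _ weak_deriv_AE[OF assms]] weak_deriv_works(1)[OF assms] assms(1)
  by (simp add: H1_norm_def L2_01_measurable flip: sqint_def)

text \<open>Cauchy-Schwarz against the constant 1 on an interval of length 1: the Sobolev embedding
  in one dimension. L2 convergence of derivatives thereby becomes uniform convergence of
  primitives.\<close>

lemma abs_primitive_le:
  assumes "D \<in> L2_01"
  shows "\<bar>LINT t|leb01. indicator {0<..<x} t * D t\<bar> \<le> sqrt (sqint D)"
proof -
  let ?I = "\<lambda>t. indicator {0<..<x} t * D t"
  have I: "?I \<in> L2_01" using assms by (intro L2_01_indicator_mult) auto
  have "\<bar>LINT t|leb01. ?I t * 1\<bar> \<le> sqrt (sqint ?I) * sqrt (sqint (\<lambda>x. 1))"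
    by (rule L2_01_Cauchy_Schwarz[OF I L2_01_const])
  moreover have "sqint ?I \<le> sqint D"
    by (rule sqint_mono[OF I assms]) (auto split: split_indicator)
  ultimately show ?thesis by (simp add: sqint_const real_sqrt_le_iff order_trans[OF _ real_sqrt_le_mono])
qed

text \<open>The last conjunct replaces \<open>u(1) = 0\<close>: it forces \<open>D\<close> to have mean zero.\<close>

definition h01_deriv :: "(real \<Rightarrow> real) \<Rightarrow> (real \<Rightarrow> real) \<Rightarrow> bool" where
  "h01_deriv u D \<longleftrightarrow> D \<in> L2_01 \<and> (\<forall>x. x \<notin> {0<..<1} \<longrightarrow> u x = 0) \<and>
     (\<forall>x\<in>{0<..<1}. u x = (LINT t|leb01. indicator {0<..<x} t * D t)) \<and>
     (\<exists>\<phi>. (\<forall>j::nat. \<phi> j \<in> test_01) \<and> (\<lambda>j. sqint (\<lambda>x. D x - deriv (\<phi> j) x)) \<longlonglongrightarrow> 0)"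

text \<open>A test function is the primitive of its own derivative, so inside (0, 1) the difference
  is again a primitive; outside, both functions vanish.\<close>

lemma h01_deriv_uniform_bound:
  assumes "h01_deriv u D" and \<phi>: "\<phi> \<in> test_01"
  shows "\<bar>u x - \<phi> x\<bar> \<le> sqrt (sqint (\<lambda>x. D x - deriv \<phi> x))"
proof (cases "x \<in> {0<..<1}")
  case True
  have D: "D \<in> L2_01" using assms by (simp add: h01_deriv_def)
  have L2: "deriv \<phi> \<in> L2_01" using \<phi> by (auto intro: test_01_L2_01 deriv_test_01)
  have i: "integrable leb01 (\<lambda>t. indicator {0<..<x} t * D t)"
    "integrable leb01 (\<lambda>t. indicator {0<..<x} t * deriv \<phi> t)"
    using D L2 by (auto intro!: L2_01_integrable L2_01_indicator_mult)
  have "u x - \<phi> x = (LINT t|leb01. indicator {0<..<x} t * D t) - (LINT t|leb01. indicator {0<..<x} t * deriv \<phi> t)"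
    using assms True integral_deriv_test_01[OF \<phi>, of x] by (simp add: h01_deriv_def)
  also have "\<dots> = (LINT t|leb01. indicator {0<..<x} t * (D t - deriv \<phi> t))"
    using i by (simp add: right_diff_distrib)
  finally show ?thesis using abs_primitive_le[OF L2_01_diff[OF D L2]] by simp
next
  case False
  then show ?thesis using assms by (simp add: h01_deriv_def test_01_eq_0 sqint_nonneg)
qed

lemma h01_deriv_approx:
  assumes "h01_deriv u D"
  obtains \<phi> \<epsilon> where "\<And>j::nat. \<phi> j \<in> test_01" "(\<lambda>j. sqint (\<lambda>x. D x - deriv (\<phi> j) x)) \<longlonglongrightarrow> 0"
    "\<And>j x. \<bar>u x - \<phi> j x\<bar> \<le> \<epsilon> j" "\<epsilon> \<longlonglongrightarrow> 0"
proof -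
  obtain \<phi> where \<phi>: "\<And>j::nat. \<phi> j \<in> test_01" and lim: "(\<lambda>j. sqint (\<lambda>x. D x - deriv (\<phi> j) x)) \<longlonglongrightarrow> 0"
    using assms unfolding h01_deriv_def by blast
  show ?thesis
  proof (rule that[OF \<phi> lim])
    show "\<bar>u x - \<phi> j x\<bar> \<le> sqrt (sqint (\<lambda>x. D x - deriv (\<phi> j) x))" for j x
      by (rule h01_deriv_uniform_bound[OF assms \<phi>])
    show "(\<lambda>j. sqrt (sqint (\<lambda>x. D x - deriv (\<phi> j) x))) \<longlonglongrightarrow> 0"
      using tendsto_real_sqrt[OF lim] unfolding real_sqrt_zero .
  qed
qed

text \<open>A uniform limit of test functions. The bound behind it holds on the whole line, so
  continuity at 0 and 1 is included, which is the boundary condition.\<close>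

lemma h01_deriv_continuous:
  assumes "h01_deriv u D" shows "continuous_on S u"
proof -
  obtain \<phi> \<epsilon> where \<phi>: "\<And>j::nat. \<phi> j \<in> test_01"
    "(\<lambda>j. sqint (\<lambda>x. D x - deriv (\<phi> j) x)) \<longlonglongrightarrow> 0"
    "\<And>j x. \<bar>u x - \<phi> j x\<bar> \<le> \<epsilon> j" "\<epsilon> \<longlonglongrightarrow> 0"
    using h01_deriv_approx[OF assms] by blast
  have "uniform_limit S \<phi> u sequentially"
  proof (rule uniform_limitI)
    fix e :: real assume "e > 0"
    then have "\<forall>\<^sub>F j in sequentially. \<epsilon> j < e" using order_tendstoD(2)[OF \<phi>(4)] by blast
    then show "\<forall>\<^sub>F j in sequentially. \<forall>x\<in>S. dist (\<phi> j x) (u x) < e"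
      by eventually_elim (use \<phi>(3) in \<open>auto simp: dist_real_def abs_minus_commute intro: le_less_trans\<close>)
  qed
  then show ?thesis
    by (rule uniform_limit_theorem[rotated])
       (simp, intro always_eventually allI test_01_continuous \<phi>(1))
qed

lemma h01_deriv_L2:
  assumes "h01_deriv u D" shows "D \<in> L2_01" "u \<in> L2_01"
proof -
  show D: "D \<in> L2_01" using assms by (simp add: h01_deriv_def)
  show "u \<in> L2_01"
  proof (rule L2_01_bounded)
    show "u \<in> borel_measurable leb01"
      by (intro borel_measurable_leb01 borel_measurable_continuous_onI h01_deriv_continuous[OF assms])
    show "\<bar>u x\<bar> \<le> sqrt (sqint D)" if "x \<in> {0<..<1}" for x
      using assms that abs_primitive_le[OF D, of x] by (simp add: h01_deriv_def)
  qed
qed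

lemma sqint_uniform_tendsto_0:
  assumes "\<And>j. F j \<in> L2_01" "\<And>j x. \<bar>F j x\<bar> \<le> \<epsilon> j" "\<epsilon> \<longlonglongrightarrow> 0"
  shows "(\<lambda>j. sqint (F j)) \<longlonglongrightarrow> 0"
proof (rule Lim_null_comparison)
  show "\<forall>\<^sub>F j in sequentially. norm (sqint (F j)) \<le> (\<epsilon> j)\<^sup>2"
    using sqint_le_bound[OF assms(1) assms(2)] by (simp add: sqint_nonneg)
  show "(\<lambda>j. (\<epsilon> j)\<^sup>2) \<longlonglongrightarrow> 0" using tendsto_power[OF assms(3), of 2] by simp
qed

text \<open>Convergence of the derivatives alone yields every mode of convergence used in later
  limits: L2 for derivative and function, and pointwise for the values at the nodes.\<close>

lemma h01_deriv_approx_L2: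
  assumes "h01_deriv u D"
  obtains \<phi> where "\<And>j::nat. \<phi> j \<in> test_01" "(\<lambda>j. sqint (\<lambda>x. D x - deriv (\<phi> j) x)) \<longlonglongrightarrow> 0"
    "(\<lambda>j. sqint (\<lambda>x. u x - \<phi> j x)) \<longlonglongrightarrow> 0" "\<And>x. (\<lambda>j. \<phi> j x) \<longlonglongrightarrow> u x"
proof -
  obtain \<phi> \<epsilon> where \<phi>: "\<And>j::nat. \<phi> j \<in> test_01" "(\<lambda>j. sqint (\<lambda>x. D x - deriv (\<phi> j) x)) \<longlonglongrightarrow> 0"
    "\<And>j x. \<bar>u x - \<phi> j x\<bar> \<le> \<epsilon> j" "\<epsilon> \<longlonglongrightarrow> 0"
    using h01_deriv_approx[OF assms] by blast
  have "(\<lambda>j. u x - \<phi> j x) \<longlonglongrightarrow> 0" for x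
    by (rule Lim_null_comparison[OF _ \<phi>(4)]) (simp add: \<phi>(3))
  then have "(\<lambda>j. u x - (u x - \<phi> j x)) \<longlonglongrightarrow> u x - 0" for x
    by (intro tendsto_diff tendsto_const)
  then have "(\<lambda>j. \<phi> j x) \<longlonglongrightarrow> u x" for x by simp
  moreover have "(\<lambda>j. sqint (\<lambda>x. u x - \<phi> j x)) \<longlonglongrightarrow> 0"
    by (rule sqint_uniform_tendsto_0[OF L2_01_diff[OF h01_deriv_L2(2)[OF assms] test_01_L2_01[OF \<phi>(1)]] \<phi>(3,4)])
  ultimately show ?thesis using that \<phi>(1,2) by blast
qed

text \<open>Integration by parts for the approximants passes to the limit by continuity of the L2
  pairing.\<close>

lemma h01_deriv_has_weak_deriv:
  assumes "h01_deriv u D" shows "has_weak_deriv u D"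
  unfolding has_weak_deriv_def
proof
  fix \<psi> assume \<psi>: "\<psi> \<in> test_01"
  note L2 = h01_deriv_L2[OF assms] test_01_L2_01[OF \<psi>] test_01_L2_01[OF deriv_test_01[OF \<psi>]]
  obtain \<phi> where \<phi>: "\<And>j::nat. \<phi> j \<in> test_01" "(\<lambda>j. sqint (\<lambda>x. D x - deriv (\<phi> j) x)) \<longlonglongrightarrow> 0"
    "(\<lambda>j. sqint (\<lambda>x. u x - \<phi> j x)) \<longlonglongrightarrow> 0" "\<And>x. (\<lambda>j. \<phi> j x) \<longlonglongrightarrow> u x"
    using h01_deriv_approx_L2[OF assms] by blast
  have "(\<lambda>j. LINT x|leb01. \<phi> j x * deriv \<psi> x) \<longlonglongrightarrow> (LINT x|leb01. u x * deriv \<psi> x)"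
    by (rule sqint_tendsto_integral[OF L2(2,4) test_01_L2_01[OF \<phi>(1)] \<phi>(3)])
  moreover have "(\<lambda>j. - (LINT x|leb01. deriv (\<phi> j) x * \<psi> x)) \<longlonglongrightarrow> - (LINT x|leb01. D x * \<psi> x)"
    by (rule tendsto_minus[OF sqint_tendsto_integral[OF L2(1,3) test_01_L2_01[OF deriv_test_01[OF \<phi>(1)]] \<phi>(2)]])
  ultimately show "(LINT x|leb01. u x * deriv \<psi> x) = - (LINT x|leb01. D x * \<psi> x)"
    unfolding integral_by_parts_test_01[OF \<phi>(1) \<psi>] by (rule LIMSEQ_unique)
qed

lemma has_weak_deriv_diff_test_01:
  assumes "u \<in> L2_01" "D \<in> L2_01" "has_weak_deriv u D" "\<phi> \<in> test_01"
  shows "has_weak_deriv (\<lambda>x. u x - \<phi> x) (\<lambda>x. D x - deriv \<phi> x)"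
  using has_weak_deriv_lincomb[of u \<phi> D "deriv \<phi>" 1 "-1"] assms has_weak_deriv_test_01[OF assms(4)]
    test_01_L2_01[OF assms(4)] test_01_L2_01[OF deriv_test_01[OF assms(4)]] by simp

lemma h01_deriv_imp_H01:
  assumes "h01_deriv u D" shows "u \<in> H01"
proof -
  note L2 = h01_deriv_L2[OF assms] and wd = h01_deriv_has_weak_deriv[OF assms]
  obtain \<phi> where \<phi>: "\<And>j::nat. \<phi> j \<in> test_01" "(\<lambda>j. sqint (\<lambda>x. D x - deriv (\<phi> j) x)) \<longlonglongrightarrow> 0"
    "(\<lambda>j. sqint (\<lambda>x. u x - \<phi> j x)) \<longlonglongrightarrow> 0" "\<And>x. (\<lambda>j. \<phi> j x) \<longlonglongrightarrow> u x"
    using h01_deriv_approx_L2[OF assms] by blast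
  have "H1_norm (\<lambda>x. u x - \<phi> j x) = sqrt (sqint (\<lambda>x. u x - \<phi> j x) + sqint (\<lambda>x. D x - deriv (\<phi> j) x))" for j
    by (intro H1_norm_eq has_weak_deriv_diff_test_01 L2 wd \<phi>(1) L2_01_diff test_01_L2_01 deriv_test_01)
  moreover have "(\<lambda>j. sqrt (sqint (\<lambda>x. u x - \<phi> j x) + sqint (\<lambda>x. D x - deriv (\<phi> j) x))) \<longlonglongrightarrow> 0"
    using tendsto_real_sqrt[OF tendsto_add_zero[OF \<phi>(3,2)]] by simp
  ultimately have "(\<lambda>j. H1_norm (\<lambda>x. u x - \<phi> j x)) \<longlonglongrightarrow> 0" by simp
  then have "\<exists>\<phi>. (\<forall>j. \<phi> j \<in> test_01) \<and> (\<lambda>j::nat. H1_norm (\<lambda>x. u x - \<phi> j x)) \<longlonglongrightarrow> 0"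
    using \<phi>(1) by blast
  moreover have "u \<in> H1_01" using L2 wd by (auto simp: H1_01_def)
  ultimately show ?thesis
    using assms h01_deriv_continuous[OF assms] by (auto simp: H01_def h01_deriv_def)
qed

text \<open>The set of disagreement is open and null, and an open null set is empty; the library
  fact on closed sets is applied with the empty set.\<close>

lemma AE_leb01_continuous_eq:
  fixes u v :: "real \<Rightarrow> real"
  assumes "AE x in leb01. u x = v x" "continuous_on {0<..<1} u" "continuous_on {0<..<1} v" "x \<in> {0<..<1}"
  shows "u x = v x"
proof (rule ccontr)
  assume ne: "u x \<noteq> v x"
  let ?U = "{y \<in> {0<..<1}. u y - v y \<noteq> 0}"
  have "open ((\<lambda>y. u y - v y) -` (- {0}) \<inter> {0<..<1})"
    using continuous_on_diff[OF assms(2,3)] by (subst (asm) continuous_on_open_vimage) auto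
  moreover have "(\<lambda>y. u y - v y) -` (- {0}) \<inter> {0<..<1} = ?U" by auto
  ultimately have "open ?U" by simp
  moreover have "AE y in lebesgue. y \<in> {0<..<1} \<longrightarrow> u y = v y"
    using assms(1) by (subst (asm) AE_restrict_space_iff) auto
  then have "AE y \<in> ?U in lebesgue. y \<in> {}" by eventually_elim auto
  ultimately have "x \<in> {}"
    using ne assms(4) by (intro mem_closed_if_AE_lebesgue_open[of ?U "{}" x]) auto
  then show False by simp
qed

lemma sqint_eq_0_AE:
  assumes "f \<in> L2_01" "sqint f = 0" shows "AE x in leb01. f x = 0"
proof -
  have "AE x in leb01. (f x)\<^sup>2 = 0"
    using assms unfolding sqint_def by (subst (asm) integral_nonneg_eq_0_iff_AE) (auto simp: L2_01_def)
  then show ?thesis by simp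
qed

text \<open>The converse of \<open>h01_deriv_imp_H01\<close>; together they replace the closure by
  explicit primitives. The approximants tend to \<open>u\<close> in L2 and uniformly to the
  primitive \<open>v\<close> of \<open>D\<close>, so \<open>u\<close> and \<open>v\<close> agree
  almost everywhere, and everywhere by continuity.\<close>

lemma H01_h01_deriv:
  assumes "u \<in> H01" shows "h01_deriv u (weak_deriv u)"
proof -
  define D where "D = weak_deriv u"
  obtain g where g: "g \<in> L2_01" "has_weak_deriv u g" and u: "u \<in> L2_01"
    using assms unfolding H01_def H1_01_def by blast
  have D: "D \<in> L2_01" "has_weak_deriv u D" using weak_deriv_works[OF g] by (auto simp: D_def)
  obtain \<phi> where \<phi>: "\<And>j::nat. \<phi> j \<in> test_01" and lim: "(\<lambda>j. H1_norm (\<lambda>x. u x - \<phi> j x)) \<longlonglongrightarrow> 0"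
    using assms unfolding H01_def by blast
  have dL2: "deriv (\<phi> j) \<in> L2_01" for j using \<phi> by (intro test_01_L2_01 deriv_test_01)
  have N: "H1_norm (\<lambda>x. u x - \<phi> j x) = sqrt (sqint (\<lambda>x. u x - \<phi> j x) + sqint (\<lambda>x. D x - deriv (\<phi> j) x))" for j
    by (intro H1_norm_eq has_weak_deriv_diff_test_01 u D \<phi> L2_01_diff dL2)
  have "(\<lambda>j. (H1_norm (\<lambda>x. u x - \<phi> j x))\<^sup>2) \<longlonglongrightarrow> 0"
    using tendsto_power[OF lim, of 2] by simp
  then have lim2: "(\<lambda>j. sqint (\<lambda>x. u x - \<phi> j x) + sqint (\<lambda>x. D x - deriv (\<phi> j) x)) \<longlonglongrightarrow> 0"
    by (simp add: N sqint_nonneg)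
  have limu: "(\<lambda>j. sqint (\<lambda>x. u x - \<phi> j x)) \<longlonglongrightarrow> 0"
    by (rule Lim_null_comparison[OF _ lim2]) (simp add: sqint_nonneg)
  have limD: "(\<lambda>j. sqint (\<lambda>x. D x - deriv (\<phi> j) x)) \<longlonglongrightarrow> 0"
    by (rule Lim_null_comparison[OF _ lim2]) (simp add: sqint_nonneg)
  define v where "v x = (if x \<in> {0<..<1} then LINT t|leb01. indicator {0<..<x} t * D t else 0)" for x
  have v: "h01_deriv v D"
    unfolding h01_deriv_def using D \<phi> limD by (auto simp: v_def)
  have vL2: "v \<in> L2_01" by (rule h01_deriv_L2(2)[OF v])
  have limv: "(\<lambda>j. sqint (\<lambda>x. \<phi> j x - v x)) \<longlonglongrightarrow> 0"
  proof (rule sqint_uniform_tendsto_0)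
    show "\<bar>\<phi> j x - v x\<bar> \<le> sqrt (sqint (\<lambda>x. D x - deriv (\<phi> j) x))" for j x
      using h01_deriv_uniform_bound[OF v \<phi>] by (simp add: abs_minus_commute)
    show "(\<lambda>j. sqrt (sqint (\<lambda>x. D x - deriv (\<phi> j) x))) \<longlonglongrightarrow> 0"
      using tendsto_real_sqrt[OF limD] unfolding real_sqrt_zero .
  qed (intro L2_01_diff test_01_L2_01 \<phi> vL2)
  have "(\<lambda>j. sqint (\<lambda>x. (u x - \<phi> j x) + (\<phi> j x - v x))) \<longlonglongrightarrow> 0"
    by (rule sqint_sum_tendsto_0[OF _ _ limu limv]) (intro L2_01_diff test_01_L2_01 \<phi> u vL2)+
  then have "sqint (\<lambda>x. u x - v x) = 0" by (simp add: LIMSEQ_const_iff)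
  then have ae: "AE x in leb01. u x = v x"
    using sqint_eq_0_AE[OF L2_01_diff[OF u vL2]] by simp
  have "u x = v x" for x
  proof (cases "x \<in> {0<..<1}")
    case True
    have "continuous_on {0<..<1} u" using assms by (simp add: H01_def)
    then show ?thesis using AE_leb01_continuous_eq[OF ae _ h01_deriv_continuous[OF v] True] by blast
  next
    case False
    then show ?thesis using assms unfolding H01_def v_def by auto
  qed
  then have "u = v" by blast
  then show ?thesis using v by (simp add: D_def)
qed

subsection \<open>Hat functions\<close>

text \<open>An antiderivative is constant to the left of a and to the right of b, and mean zero
  makes the two constants equal; subtracting the constant leaves compact support.\<close>

lemma primitive_test_01:
  assumes e: "e \<in> elem_smooth" and ab: "0 < a" "b < 1" "\<And>x. x \<notin> {a..b} \<Longrightarrow> e x = 0"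
    and int0: "(LINT x|leb01. e x) = 0"
  shows "\<exists>\<phi>\<in>test_01. deriv \<phi> = e"
proof -
  have "\<exists>F. \<forall>x::real. - \<infinity> < ereal x \<longrightarrow> ereal x < \<infinity> \<longrightarrow> (F has_vector_derivative e x) (at x)"
    by (rule einterval_antiderivative)
       (use elem_smooth_continuous[OF e, of UNIV] in \<open>auto simp: continuous_on_eq_continuous_at[OF open_UNIV]\<close>)
  then obtain F where F: "\<And>x. (F has_field_derivative e x) (at x)"
    by (auto simp: has_real_derivative_iff_has_vector_derivative)
  have cont: "continuous_on UNIV e" by (rule elem_smooth_continuous[OF e])
  have const: "F x = F y" if "convex S" "S \<inter> {a..b} = {}" "x \<in> S" "y \<in> S" for S x y
  proof -
    have "\<exists>c. \<forall>x\<in>S. F x = c"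
    proof (rule has_field_derivative_zero_constant[OF that(1)])
      fix x assume "x \<in> S"
      then have "e x = 0" using ab that(2) by blast
      then show "(F has_field_derivative 0) (at x within S)"
        using F[of x] by (simp add: has_field_derivative_at_within)
    qed
    then show ?thesis using that by auto
  qed
  have "F 1 - F 0 = (LINT x|leb01. indicator {0<..<1} x * e x)"
    by (rule integral_leb01_FTC[symmetric]) (use F cont in auto)
  also have "\<dots> = (LINT x|leb01. e x)" by (rule integral_leb01_cong) simp
  finally have F01: "F 1 = F 0" using int0 by simp
  define \<phi> where "\<phi> x = F x - F 0" for x
  have D: "(\<phi> has_field_derivative e x) (at x)" for x
    unfolding \<phi>_def using F by (auto intro!: derivative_eq_intros)
  then have de: "deriv \<phi> = e" by (auto intro: DERIV_imp_deriv)
  have "\<phi> x = 0" if "x \<notin> {a..b}" for x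
  proof (cases "x < a")
    case True
    have "{..<a} \<inter> {a..b} = {}" by auto
    then show ?thesis using True const[of "{..<a}" x 0] ab(1) by (simp add: \<phi>_def)
  next
    case False
    then have "x \<in> {b<..}" using that by auto
    moreover have "{b<..} \<inter> {a..b} = {}" by auto
    ultimately show ?thesis using const[of "{b<..}" x 1] ab(2) F01 by (simp add: \<phi>_def)
  qed
  moreover have "(deriv ^^ k) \<phi> differentiable_on UNIV" for k
  proof (cases k)
    case 0
    then show ?thesis using D by (auto simp: differentiable_on_def real_differentiable_def)
  next
    \<comment> \<open>The derivative of order m + 1 of \<open>\<phi>\<close> is the derivative of
      order m of \<open>e\<close>, so \<open>e\<close> alone has to lie in
      \<open>elem_smooth\<close>.\<close>
    case (Suc m)
    then show ?thesis using elem_smooth_differentiable[OF e, of m] by (simp add: funpow_swap1 de)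
  qed
  ultimately have "\<phi> \<in> test_01" using ab unfolding test_01_def by blast
  then show ?thesis using de by blast
qed

lemma AE_leb01_neq: "AE x in leb01. x \<noteq> b"
proof -
  have "AE x in lebesgue. x \<noteq> b" by (rule AE_completion) (rule AE_lborel_singleton)
  then show ?thesis by (subst AE_restrict_space_iff) auto
qed

lemma sqint_dominated_tendsto_0:
  assumes "\<And>m. F m \<in> borel_measurable leb01" "\<And>m x. x \<in> {0<..<1} \<Longrightarrow> \<bar>F m x\<bar> \<le> B"
    "\<And>x. x \<in> {0<..<1} \<Longrightarrow> (\<lambda>m. F m x) \<longlonglongrightarrow> 0"
  shows "(\<lambda>m. sqint (F m)) \<longlonglongrightarrow> 0"
proof -
  have "(\<lambda>m. LINT x|leb01. (F m x)\<^sup>2) \<longlonglongrightarrow> (LINT x|leb01. 0)"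
  proof (rule integral_dominated_convergence)
    show "integrable leb01 (\<lambda>x. B\<^sup>2)" using L2_01_integrable[OF L2_01_const] .
    show "AE x in leb01. norm ((F m x)\<^sup>2) \<le> B\<^sup>2" for m
      using assms(2)[of _ m] by (intro AE_I2) (simp add: abs_le_square_iff[symmetric] order_trans[OF _ abs_ge_self])
    show "AE x in leb01. (\<lambda>m. (F m x)\<^sup>2) \<longlonglongrightarrow> 0"
    proof (rule AE_I2)
      fix x assume "x \<in> space leb01"
      then show "(\<lambda>m. (F m x)\<^sup>2) \<longlonglongrightarrow> 0" using tendsto_power[OF assms(3)[of x], of 2] by simp
    qed
    show "(\<lambda>x. (F m x)\<^sup>2) \<in> borel_measurable leb01" for m
      using assms(1) by (rule borel_measurable_power)
  qed simp
  then show ?thesis by (simp add: sqint_def)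
qed

lemma elem_smooth_measurable: "f \<in> elem_smooth \<Longrightarrow> f \<in> borel_measurable leb01"
  by (intro borel_measurable_leb01 borel_measurable_continuous_onI elem_smooth_continuous)

text \<open>The approximations are corrected by a multiple of a fixed bump, so that their primitives have
  compact support.\<close>

lemma h01_deriv_dominatedI:
  assumes Dm: "D \<in> borel_measurable leb01" and DB: "\<And>x. x \<in> {0<..<1} \<Longrightarrow> \<bar>D x\<bar> \<le> B"
    and d: "\<And>m. d m \<in> elem_smooth" and dB: "\<And>m x. x \<in> {0<..<1} \<Longrightarrow> \<bar>d m x\<bar> \<le> B"
    and supp: "\<And>m. \<exists>a b. 0 < a \<and> b < 1 \<and> (\<forall>x. x \<notin> {a..b} \<longrightarrow> d m x = 0)"
    and lim: "\<And>x. x \<in> {0<..<1} \<Longrightarrow> (\<lambda>m. d m x) \<longlonglongrightarrow> D x"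
    and int0: "(LINT x|leb01. D x) = 0"
    and u0: "\<And>x. x \<notin> {0<..<1} \<Longrightarrow> u x = 0"
    and u: "\<And>x. x \<in> {0<..<1} \<Longrightarrow> u x = (LINT t|leb01. indicator {0<..<x} t * D t)"
  shows "h01_deriv u D"
proof -
  have dL2: "d m \<in> L2_01" for m
    using elem_smooth_measurable[OF d] dB by (rule L2_01_bounded)
  have DL2: "D \<in> L2_01" using Dm DB by (rule L2_01_bounded)
  have l1: "(\<lambda>m. sqint (\<lambda>x. D x - d m x)) \<longlonglongrightarrow> 0"
  proof (rule sqint_dominated_tendsto_0[where B = "2 * B"])
    show "(\<lambda>x. D x - d m x) \<in> borel_measurable leb01" for m
      by (intro borel_measurable_diff Dm elem_smooth_measurable d)
    show "\<bar>D x - d m x\<bar> \<le> 2 * B" if "x \<in> {0<..<1}" for m x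
      using DB[OF that] dB[OF that, of m] by linarith
    show "(\<lambda>m. D x - d m x) \<longlonglongrightarrow> 0" if "x \<in> {0<..<1}" for x
      using tendsto_diff[OF tendsto_const lim[OF that], of "D x"] by simp
  qed
  \<comment> \<open>The integrals of the bumps tend to 1, so some bump has a positive integral and
    can carry the correction.\<close>
  have "(\<lambda>m. LINT x|leb01. bump 0 1 (Suc m) x * 1) \<longlonglongrightarrow> (LINT x|leb01. indicator {0<..<1} x * 1)"
    by (rule integral_bump_tendsto[OF L2_01_const])
  moreover have "(LINT x|leb01. indicator {0<..<1} x * 1) = (LINT x|leb01. (1::real))"
    by (rule integral_leb01_cong) simp
  ultimately have "(\<lambda>m. LINT x|leb01. bump 0 1 (Suc m) x) \<longlonglongrightarrow> 1"
    by (simp add: measure_leb01)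
  then have "\<forall>\<^sub>F m in sequentially. (LINT x|leb01. bump 0 1 (Suc m) x) > 0"
    by (rule order_tendstoD) simp
  then obtain m0 where m0: "(LINT x|leb01. bump 0 1 (Suc m0) x) > 0"
    using eventually_happens by fastforce
  define \<rho> where "\<rho> = bump 0 1 (Suc m0)"
  have \<rho>: "\<rho> \<in> elem_smooth" "\<rho> \<in> L2_01" "\<And>x. 0 \<le> \<rho> x" "\<And>x. \<rho> x \<le> 1"
    using bump_elem_smooth test_01_L2_01[OF bump_test_01[of 0 1 "Suc m0"]] bump_bounds by (auto simp: \<rho>_def)
  define r where "r = (LINT x|leb01. \<rho> x)"
  have r: "r > 0" using m0 by (simp add: r_def \<rho>_def)
  define c where "c m = (LINT x|leb01. d m x) / r" for m
  have "(\<lambda>m. LINT x|leb01. d m x * 1) \<longlonglongrightarrow> (LINT x|leb01. D x * 1)"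
    by (rule sqint_tendsto_integral[OF DL2 L2_01_const dL2 l1])
  \<comment> \<open>\<open>D\<close> has mean zero, so the corrections die out in the limit.\<close>
  then have "(\<lambda>m. LINT x|leb01. d m x) \<longlonglongrightarrow> 0" by (simp add: int0)
  then have c: "c \<longlonglongrightarrow> 0"
    unfolding c_def[abs_def] by (rule tendsto_divide_zero)
  have l2: "(\<lambda>m. sqint (\<lambda>x. c m * \<rho> x)) \<longlonglongrightarrow> 0"
  proof (rule sqint_uniform_tendsto_0)
    show "\<bar>c m * \<rho> x\<bar> \<le> \<bar>c m\<bar>" for m x using \<rho>(3,4)[of x] by (simp add: abs_mult mult_left_le)
    show "(\<lambda>m. \<bar>c m\<bar>) \<longlonglongrightarrow> 0" using c by (rule tendsto_rabs_zero)
  qed (intro L2_01_scale \<rho>)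
  have l3: "(\<lambda>m. sqint (\<lambda>x. (D x - d m x) + c m * \<rho> x)) \<longlonglongrightarrow> 0"
    by (rule sqint_sum_tendsto_0[OF L2_01_diff[OF DL2 dL2] L2_01_scale[OF \<rho>(2)] l1 l2])
  have ex: "\<exists>\<phi>\<in>test_01. deriv \<phi> = (\<lambda>x. d m x - c m * \<rho> x)" for m
  proof -
    obtain a b where ab: "0 < a" "b < 1" "\<And>x. x \<notin> {a..b} \<Longrightarrow> d m x = 0" using supp[of m] by blast
    define s where "s = 1 / real (Suc m0)"
    have s: "0 < s" "1 - s < 1" by (auto simp: s_def)
    have \<rho>0: "\<rho> x = 0" if "x \<notin> {s..1 - s}" for x
      unfolding \<rho>_def by (rule bump_eq_0) (use that in \<open>auto simp: s_def\<close>)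
    show ?thesis
    proof (rule primitive_test_01[where a = "min a s" and b = "max b (1 - s)"])
      show "(\<lambda>x. d m x - c m * \<rho> x) \<in> elem_smooth"
        by (intro elem_smooth_diff elem_smooth_scale d \<rho>)
      show "0 < min a s" "max b (1 - s) < 1" using ab s by auto
      show "d m x - c m * \<rho> x = 0" if "x \<notin> {min a s..max b (1 - s)}" for x
      proof -
        have "x \<notin> {a..b}" "x \<notin> {s..1 - s}" using that by auto
        then show ?thesis using ab \<rho>0 by simp
      qed
      have "(LINT x|leb01. d m x - c m * \<rho> x) = (LINT x|leb01. d m x) - c m * r"
        using L2_01_integrable[OF dL2[of m]] L2_01_integrable[OF \<rho>(2)] by (simp add: r_def)
      then show "(LINT x|leb01. d m x - c m * \<rho> x) = 0" using r by (simp add: c_def)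
    qed
  qed
  obtain \<phi> where \<phi>: "\<And>m. \<phi> m \<in> test_01" "\<And>m. deriv (\<phi> m) = (\<lambda>x. d m x - c m * \<rho> x)"
    using ex by metis
  have "(\<lambda>m. sqint (\<lambda>x. D x - deriv (\<phi> m) x)) \<longlonglongrightarrow> 0"
    using l3 by (simp add: \<phi>(2) algebra_simps)
  then show ?thesis
    unfolding h01_deriv_def using DL2 u0 u \<phi>(1) by blast
qed

section \<open>Hat functions over a general profile\<close>

definition hat :: "(real \<Rightarrow> real) \<Rightarrow> real \<Rightarrow> real \<Rightarrow> real \<Rightarrow> real" where
  "hat \<sigma> h b x = (if \<bar>x - b\<bar> < h then \<sigma> (h - \<bar>x - b\<bar>) else 0)"

text \<open>At the kink b and at both ends of the support the value is 0, a convention on a null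
  set.\<close>

definition dhat :: "(real \<Rightarrow> real) \<Rightarrow> real \<Rightarrow> real \<Rightarrow> real \<Rightarrow> real" where
  "dhat \<tau> h b x = indicator {b - h<..<b} x * \<tau> (x - (b - h)) - indicator {b<..<b + h} x * \<tau> (b + h - x)"

text \<open>\<open>\<sigma>\<close> and \<open>\<tau>\<close> form the first-order system of
  \<sigma>'' = q \<sigma>, so the linear profile of q = 0 and the hyperbolic one of q > 0 are
  treated together. Smoothness is asked of \<open>\<tau>\<close>, from which the approximations of
  \<open>dhat\<close> are built.\<close>

locale hat_profile =
  fixes \<sigma> \<tau> :: "real \<Rightarrow> real" and q h :: real
  assumes sigma: "\<And>t. (\<sigma> has_field_derivative \<tau> t) (at t)"
    and tau: "\<And>t. (\<tau> has_field_derivative q * \<sigma> t) (at t)"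
    and sigma_0: "\<sigma> 0 = 0" and tau_0: "\<tau> 0 = 1"
    and tau_smooth: "\<tau> \<in> elem_smooth"
    and h_pos: "h > 0"
begin

lemma sigma_cont: "continuous_on S \<sigma>" and tau_cont: "continuous_on S \<tau>"
  using sigma tau by (meson DERIV_continuous_on has_field_derivative_at_within)+

lemma tau_left: "(\<lambda>x. \<tau> (x - c)) \<in> elem_smooth" and tau_right: "(\<lambda>x. \<tau> (c - x)) \<in> elem_smooth"
  using elem_smooth_affine[OF tau_smooth, of 1 "- c"] elem_smooth_affine[OF tau_smooth, of "-1" c] by simp_all

lemma dhat_primitive:
  assumes b: "0 \<le> b - h" "b + h \<le> 1" and x: "0 \<le> x" "x \<le> 1"
  shows "(LINT t|leb01. indicator {0<..<x} t * dhat \<tau> h b t) = hat \<sigma> h b x"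
proof -
  \<comment> \<open>These are x clamped to the left and to the right half of the support, so that
    one use of the fundamental theorem per half covers every position of x.\<close>
  define u v where "u = max (b - h) (min x b)" and "v = max b (min x (b + h))"
  have 1: "has_bochner_integral leb01 (\<lambda>t. indicator {b - h<..<u} t * \<tau> (t - (b - h)))
      (\<sigma> (u - (b - h)) - \<sigma> (b - h - (b - h)))"
    by (rule has_bochner_integral_leb01[where F = "\<lambda>t. \<sigma> (t - (b - h))"])
       (use b h_pos x in \<open>auto simp: u_def intro!: DERIV_chain2[OF sigma, THEN DERIV_cong]
          derivative_eq_intros elem_smooth_continuous tau_left\<close>)
  have 2: "has_bochner_integral leb01 (\<lambda>t. indicator {b<..<v} t * \<tau> (b + h - t))
      (- \<sigma> (b + h - v) - - \<sigma> (b + h - b))"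
    by (rule has_bochner_integral_leb01[where F = "\<lambda>t. - \<sigma> (b + h - t)"])
       (use b h_pos x in \<open>auto simp: v_def intro!: DERIV_chain2[OF sigma, THEN DERIV_cong]
          derivative_eq_intros elem_smooth_continuous tau_right\<close>)
  have "(LINT t|leb01. indicator {0<..<x} t * dhat \<tau> h b t) =
      (LINT t|leb01. indicator {b - h<..<u} t * \<tau> (t - (b - h)) - indicator {b<..<v} t * \<tau> (b + h - t))"
    by (rule integral_leb01_cong) (auto simp: dhat_def u_def v_def indicator_def)
  also have "\<dots> = \<sigma> (u - (b - h)) + \<sigma> (b + h - v) - \<sigma> h"
    using 1 2 by (simp add: sigma_0 has_bochner_integral_iff)
  also have "\<dots> = hat \<sigma> h b x"
  proof -
    consider "x \<le> b - h" | "b - h < x" "x \<le> b" | "b < x" "x < b + h" | "b + h \<le> x" by linarith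
    then show ?thesis
    proof cases
      case 1
      then have "u = b - h" "v = b" using h_pos by (auto simp: u_def v_def)
      then show ?thesis using 1 h_pos by (simp add: hat_def sigma_0)
    next
      case 2
      then have "u = x" "v = b" using h_pos by (auto simp: u_def v_def)
      then show ?thesis using 2 h_pos by (auto simp: hat_def algebra_simps)
    next
      case 3
      then have "u = b" "v = x" using h_pos by (auto simp: u_def v_def)
      then show ?thesis using 3 h_pos by (simp add: hat_def algebra_simps)
    next
      case 4
      then have "u = b" "v = b + h" using h_pos by (auto simp: u_def v_def)
      then show ?thesis using 4 h_pos by (simp add: hat_def sigma_0)
    qed
  qed
  finally show ?thesis .
qed

lemma dhat_measurable: "dhat \<tau> h b \<in> borel_measurable leb01"
proof -
  have "(\<lambda>x. \<tau> (x - (b - h))) \<in> borel_measurable borel" "(\<lambda>x. \<tau> (b + h - x)) \<in> borel_measurable borel"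
    by (intro borel_measurable_continuous_onI elem_smooth_continuous tau_left tau_right)+
  note [measurable] = this
  show ?thesis unfolding dhat_def[abs_def] by (intro borel_measurable_leb01) measurable
qed

text \<open>Replacing the indicators in \<open>dhat\<close> by bumps gives smooth approximants with
  the same bound and with support inside (0, 1). The mean of \<open>dhat\<close> is zero because the
  hat vanishes at 1.\<close>

lemma h01_deriv_hat:
  assumes b: "0 \<le> b - h" "b + h \<le> 1"
  shows "h01_deriv (hat \<sigma> h b) (dhat \<tau> h b)"
proof -
  \<comment> \<open>For x in (0, 1) both arguments of \<open>\<tau>\<close> stay in [-1, 1], since b
    - h and b + h lie in [0, 1].\<close>
  have "bounded (\<tau> ` {-1..1})"
    by (intro compact_imp_bounded compact_continuous_image tau_cont) auto
  then obtain T where T: "\<And>t. t \<in> {-1..1} \<Longrightarrow> \<bar>\<tau> t\<bar> \<le> T"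
    by (auto simp: bounded_iff simp del: atLeastAtMost_iff)
  have T0: "0 \<le> T" using T[of 0] by auto
  \<comment> \<open>The weights s and r stand for the indicators and for the bumps alike.\<close>
  have TB: "\<bar>s * \<tau> (x - (b - h)) - r * \<tau> (b + h - x)\<bar> \<le> 2 * T"
    if "0 \<le> s" "s \<le> 1" "0 \<le> r" "r \<le> 1" "x \<in> {0<..<1}" for s r x
  proof -
    have "\<bar>\<tau> (x - (b - h))\<bar> \<le> T" "\<bar>\<tau> (b + h - x)\<bar> \<le> T"
      using that b h_pos by (auto intro!: T)
    then have "\<bar>s * \<tau> (x - (b - h))\<bar> \<le> 1 * T" "\<bar>r * \<tau> (b + h - x)\<bar> \<le> 1 * T"
      unfolding abs_mult using that T0 by (intro mult_mono; simp)+
    then show ?thesis by linarith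
  qed
  define d where "d m x = bump (b - h) b (Suc m) x * \<tau> (x - (b - h)) - bump b (b + h) (Suc m) x * \<tau> (b + h - x)" for m x
  show ?thesis
  proof (rule h01_deriv_dominatedI[where B = "2 * T" and d = d])
    show "dhat \<tau> h b \<in> borel_measurable leb01" by (rule dhat_measurable)
    show "\<bar>dhat \<tau> h b x\<bar> \<le> 2 * T" if "x \<in> {0<..<1}" for x
      unfolding dhat_def by (rule TB) (use that in auto)
    show "\<bar>d m x\<bar> \<le> 2 * T" if "x \<in> {0<..<1}" for m x
      unfolding d_def by (rule TB) (use that bump_bounds in auto)
    show "d m \<in> elem_smooth" for m
      unfolding d_def[abs_def] by (intro elem_smooth_diff elem_smooth.mult bump_elem_smooth tau_left tau_right)
    show "(\<lambda>m. d m x) \<longlonglongrightarrow> dhat \<tau> h b x" for x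
      unfolding d_def dhat_def by (intro tendsto_intros LIMSEQ_Suc bump_tendsto)
    show "\<exists>a b. 0 < a \<and> b < 1 \<and> (\<forall>x. x \<notin> {a..b} \<longrightarrow> d m x = 0)" for m
    proof (intro exI conjI allI impI)
      show "0 < 1 / real (Suc m)" "1 - 1 / real (Suc m) < 1" by auto
      fix x assume x: "x \<notin> {1 / real (Suc m)..1 - 1 / real (Suc m)}"
      have "bump (b - h) b (Suc m) x = 0" "bump b (b + h) (Suc m) x = 0"
        by (rule bump_eq_0; use x b h_pos in auto)+
      then show "d m x = 0" by (simp add: d_def)
    qed
    have "(LINT t|leb01. dhat \<tau> h b t) = (LINT t|leb01. indicator {0<..<1} t * dhat \<tau> h b t)"
      by (rule integral_leb01_cong) simp
    also have "\<dots> = hat \<sigma> h b 1" by (rule dhat_primitive) (use b in auto)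
    finally show "(LINT t|leb01. dhat \<tau> h b t) = 0" using b by (simp add: hat_def)
    show "hat \<sigma> h b x = 0" if "x \<notin> {0<..<1}" for x
      using that b by (auto simp: hat_def)
    show "hat \<sigma> h b x = (LINT t|leb01. indicator {0<..<x} t * dhat \<tau> h b t)" if "x \<in> {0<..<1}" for x
      by (rule dhat_primitive[symmetric]) (use that b in auto)
  qed
qed

text \<open>Since \<tau>' = q \<sigma>, the integrand on each half is the exact derivative of \<tau>
  times \<phi>, up to sign. The outer ends contribute the factor \<open>\<tau> 0\<close> = 1, and
  each side of b contributes \<open>\<tau> h\<close>.\<close>

lemma hat_green_test_01:
  assumes b: "0 \<le> b - h" "b + h \<le> 1" and \<phi>: "\<phi> \<in> test_01"
  shows "(LINT x|leb01. dhat \<tau> h b x * deriv \<phi> x) + q * (LINT x|leb01. hat \<sigma> h b x * \<phi> x) =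
    2 * \<tau> h * \<phi> b - \<phi> (b - h) - \<phi> (b + h)"
proof -
  define l r where "l x = q * \<sigma> (x - (b - h)) * \<phi> x + \<tau> (x - (b - h)) * deriv \<phi> x"
    and "r x = q * \<sigma> (b + h - x) * \<phi> x - \<tau> (b + h - x) * deriv \<phi> x" for x
  have cont: "continuous_on UNIV (\<lambda>x. \<sigma> (x - c))" "continuous_on UNIV (\<lambda>x. \<sigma> (c - x))" for c
    by (intro continuous_on_compose2[OF sigma_cont[of UNIV]] continuous_intros; simp)+
  have 1: "has_bochner_integral leb01 (\<lambda>x. indicator {b - h<..<b} x * l x)
      (\<tau> (b - (b - h)) * \<phi> b - \<tau> (b - h - (b - h)) * \<phi> (b - h))"
  proof (rule has_bochner_integral_leb01[where F = "\<lambda>x. \<tau> (x - (b - h)) * \<phi> x"])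
    show "((\<lambda>x. \<tau> (x - (b - h)) * \<phi> x) has_field_derivative l x) (at x)" for x
      unfolding l_def
      by (auto intro!: derivative_eq_intros DERIV_chain2[OF tau] test_01_DERIV[OF \<phi>])
    show "continuous_on UNIV l" unfolding l_def[abs_def]
      by (intro continuous_intros cont test_01_continuous deriv_test_01 \<phi> elem_smooth_continuous tau_left)
  qed (use b h_pos in auto)
  have 2: "has_bochner_integral leb01 (\<lambda>x. indicator {b<..<b + h} x * r x)
      (- \<tau> (b + h - (b + h)) * \<phi> (b + h) - - \<tau> (b + h - b) * \<phi> b)"
  proof (rule has_bochner_integral_leb01[where F = "\<lambda>x. - \<tau> (b + h - x) * \<phi> x"])
    show "((\<lambda>x. - \<tau> (b + h - x) * \<phi> x) has_field_derivative r x) (at x)" for x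
      unfolding r_def
      by (auto intro!: derivative_eq_intros DERIV_chain2[OF tau] test_01_DERIV[OF \<phi>])
    show "continuous_on UNIV r" unfolding r_def[abs_def]
      by (intro continuous_intros cont test_01_continuous deriv_test_01 \<phi> elem_smooth_continuous tau_right)
  qed (use b h_pos in auto)
  note hat = h01_deriv_L2[OF h01_deriv_hat[OF b]]
  have i1: "integrable leb01 (\<lambda>x. dhat \<tau> h b x * deriv \<phi> x)"
    by (rule L2_01_mult_integrable[OF hat(1) test_01_L2_01[OF deriv_test_01[OF \<phi>]]])
  have i2: "integrable leb01 (\<lambda>x. hat \<sigma> h b x * \<phi> x)"
    by (rule L2_01_mult_integrable[OF hat(2) test_01_L2_01[OF \<phi>]])
  have "(LINT x|leb01. dhat \<tau> h b x * deriv \<phi> x) + q * (LINT x|leb01. hat \<sigma> h b x * \<phi> x) =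
      (LINT x|leb01. dhat \<tau> h b x * deriv \<phi> x + q * (hat \<sigma> h b x * \<phi> x))"
    using i1 i2 by simp
  also have "\<dots> = (LINT x|leb01. indicator {b - h<..<b} x * l x + indicator {b<..<b + h} x * r x)"
  \<comment> \<open>At b itself both indicators vanish while the hat is at its centre, so equality
    is claimed only almost everywhere.\<close>
  proof (rule integral_cong_AE)
    show "AE x in leb01. dhat \<tau> h b x * deriv \<phi> x + q * (hat \<sigma> h b x * \<phi> x) =
        indicator {b - h<..<b} x * l x + indicator {b<..<b + h} x * r x"
      using AE_leb01_neq[of b]
    proof eventually_elim
      case (elim x)
      consider "x \<le> b - h" | "b - h < x" "x < b" | "b < x" "x < b + h" | "b + h \<le> x"
        using elim by linarith
      then show ?case
        by cases (use h_pos in \<open>auto simp: dhat_def hat_def l_def r_def algebra_simps\<close>)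
    qed
    show "(\<lambda>x. dhat \<tau> h b x * deriv \<phi> x + q * (hat \<sigma> h b x * \<phi> x)) \<in> borel_measurable leb01"
      using i1 i2 by (intro borel_measurable_integrable) simp
    show "(\<lambda>x. indicator {b - h<..<b} x * l x + indicator {b<..<b + h} x * r x) \<in> borel_measurable leb01"
      using 1 2 by (intro borel_measurable_integrable) (simp add: has_bochner_integral_iff)
  qed
  also have "\<dots> = 2 * \<tau> h * \<phi> b - \<phi> (b - h) - \<phi> (b + h)"
    using 1 2 by (simp add: tau_0 has_bochner_integral_iff)
  finally show ?thesis .
qed

text \<open>Density: the integrals converge by L2 approximation, the node values pointwise.\<close>

lemma hat_green:
  assumes b: "0 \<le> b - h" "b + h \<le> 1" and u: "h01_deriv u D"
  shows "(LINT x|leb01. dhat \<tau> h b x * D x) + q * (LINT x|leb01. hat \<sigma> h b x * u x) =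
    2 * \<tau> h * u b - u (b - h) - u (b + h)"
proof -
  note hat = h01_deriv_L2[OF h01_deriv_hat[OF b]] and uL2 = h01_deriv_L2[OF u]
  obtain \<phi> where \<phi>: "\<And>j::nat. \<phi> j \<in> test_01" "(\<lambda>j. sqint (\<lambda>x. D x - deriv (\<phi> j) x)) \<longlonglongrightarrow> 0"
    "(\<lambda>j. sqint (\<lambda>x. u x - \<phi> j x)) \<longlonglongrightarrow> 0" "\<And>x. (\<lambda>j. \<phi> j x) \<longlonglongrightarrow> u x"
    using h01_deriv_approx_L2[OF u] by blast
  have "(\<lambda>j. (LINT x|leb01. deriv (\<phi> j) x * dhat \<tau> h b x) + q * (LINT x|leb01. \<phi> j x * hat \<sigma> h b x))
      \<longlonglongrightarrow> (LINT x|leb01. D x * dhat \<tau> h b x) + q * (LINT x|leb01. u x * hat \<sigma> h b x)"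
    by (intro tendsto_add tendsto_mult tendsto_const sqint_tendsto_integral uL2 hat \<phi>(2,3)
          test_01_L2_01 deriv_test_01 \<phi>(1))
  moreover have "(\<lambda>j. 2 * \<tau> h * \<phi> j b - \<phi> j (b - h) - \<phi> j (b + h)) \<longlonglongrightarrow> 2 * \<tau> h * u b - u (b - h) - u (b + h)"
    by (intro tendsto_diff tendsto_mult tendsto_const \<phi>(4))
  moreover have "(LINT x|leb01. deriv (\<phi> j) x * dhat \<tau> h b x) + q * (LINT x|leb01. \<phi> j x * hat \<sigma> h b x) =
      2 * \<tau> h * \<phi> j b - \<phi> j (b - h) - \<phi> j (b + h)" for j
    using hat_green_test_01[OF b \<phi>(1)] by (simp add: mult.commute)
  ultimately have "(LINT x|leb01. D x * dhat \<tau> h b x) + q * (LINT x|leb01. u x * hat \<sigma> h b x) =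
      2 * \<tau> h * u b - u (b - h) - u (b + h)"
    using LIMSEQ_unique by simp
  then show ?thesis by (simp add: mult.commute)
qed

end

subsection \<open>Reduction to a recurrence on the grid\<close>

lemma sqint_scale: "sqint (\<lambda>x. c * f x) = c\<^sup>2 * sqint f"
  by (simp add: sqint_def power_mult_distrib)

lemma h01_deriv_zero: "h01_deriv (\<lambda>x. 0) (\<lambda>x. 0)"
  unfolding h01_deriv_def
proof (intro conjI exI[of _ "\<lambda>j. \<lambda>x. 0"] allI)
  have "(\<lambda>x::real. 0::real) \<in> elem_smooth" by (rule elem_smooth.const)
  then show "(\<lambda>x. 0) \<in> test_01" by (rule elem_smooth_test_01[of _ "1/2" "1/2"]) auto
qed (auto simp: L2_01_const sqint_const)

lemma h01_deriv_lincomb: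
  assumes u: "h01_deriv u D" and v: "h01_deriv v E"
  shows "h01_deriv (\<lambda>x. c * u x + d * v x) (\<lambda>x. c * D x + d * E x)"
proof -
  obtain \<phi> where \<phi>: "\<And>j::nat. \<phi> j \<in> test_01" "(\<lambda>j. sqint (\<lambda>x. D x - deriv (\<phi> j) x)) \<longlonglongrightarrow> 0"
    using u unfolding h01_deriv_def by blast
  obtain \<psi> where \<psi>: "\<And>j::nat. \<psi> j \<in> test_01" "(\<lambda>j. sqint (\<lambda>x. E x - deriv (\<psi> j) x)) \<longlonglongrightarrow> 0"
    using v unfolding h01_deriv_def by blast
  note uL2 = h01_deriv_L2[OF u] and vL2 = h01_deriv_L2[OF v]
  have dL2: "deriv (\<phi> j) \<in> L2_01" "deriv (\<psi> j) \<in> L2_01" for j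
    using \<phi> \<psi> by (auto intro: test_01_L2_01 deriv_test_01)
  have "deriv (\<lambda>x. c * \<phi> j x + d * \<psi> j x) = (\<lambda>x. c * deriv (\<phi> j) x + d * deriv (\<psi> j) x)" for j
    using deriv_iterate_add_scale[OF \<phi>(1) \<psi>(1), of 1] by simp
  moreover have "(\<lambda>j. sqint (\<lambda>x. c * (D x - deriv (\<phi> j) x) + d * (E x - deriv (\<psi> j) x))) \<longlonglongrightarrow> 0"
  proof (rule sqint_sum_tendsto_0)
    show "(\<lambda>x. c * (D x - deriv (\<phi> j) x)) \<in> L2_01" "(\<lambda>x. d * (E x - deriv (\<psi> j) x)) \<in> L2_01" for j
      by (intro L2_01_scale L2_01_diff uL2 vL2 dL2)+
    show "(\<lambda>j. sqint (\<lambda>x. c * (D x - deriv (\<phi> j) x))) \<longlonglongrightarrow> 0"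
      unfolding sqint_scale by (rule tendsto_mult_right_zero[OF \<phi>(2)])
    show "(\<lambda>j. sqint (\<lambda>x. d * (E x - deriv (\<psi> j) x))) \<longlonglongrightarrow> 0"
      unfolding sqint_scale by (rule tendsto_mult_right_zero[OF \<psi>(2)])
  qed
  ultimately have "(\<lambda>j. sqint (\<lambda>x. (c * D x + d * E x) - deriv (\<lambda>x. c * \<phi> j x + d * \<psi> j x) x)) \<longlonglongrightarrow> 0"
    by (simp add: algebra_simps)
  moreover have "(LINT t|leb01. indicator {0<..<x} t * (c * D t + d * E t)) =
      c * (LINT t|leb01. indicator {0<..<x} t * D t) + d * (LINT t|leb01. indicator {0<..<x} t * E t)" for x
  proof -
    have "integrable leb01 (\<lambda>t. indicator {0<..<x} t * D t)" "integrable leb01 (\<lambda>t. indicator {0<..<x} t * E t)"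
      using uL2 vL2 by (auto intro!: L2_01_integrable L2_01_indicator_mult)
    then show ?thesis by (simp add: distrib_left mult.left_commute)
  qed
  moreover have "(\<lambda>x. c * D x + d * E x) \<in> L2_01" by (intro L2_01_add L2_01_scale uL2 vL2)
  moreover have "\<And>j. (\<lambda>x. c * \<phi> j x + d * \<psi> j x) \<in> test_01" by (rule test_01_lincomb[OF \<phi>(1) \<psi>(1)])
  ultimately show ?thesis using u v unfolding h01_deriv_def
    by (intro conjI exI[of _ "\<lambda>j. \<lambda>x. c * \<phi> j x + d * \<psi> j x"]) auto
qed

lemma h01_deriv_sum:
  assumes "finite S" "\<And>k. k \<in> S \<Longrightarrow> h01_deriv (u k) (D k)"
  shows "h01_deriv (\<lambda>x. \<Sum>k\<in>S. c k * u k x) (\<lambda>x. \<Sum>k\<in>S. c k * D k x)"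
  using assms
proof (induction S)
  case empty
  then show ?case by (simp add: h01_deriv_zero)
next
  case (insert k S)
  then show ?case
    using h01_deriv_lincomb[of "u k" "D k" "\<lambda>x. \<Sum>k\<in>S. c k * u k x" "\<lambda>x. \<Sum>k\<in>S. c k * D k x" "c k" 1]
    by simp
qed

section \<open>The weak form of the eigenvalue equation\<close>

lemma h01_deriv_weak_deriv_AE: "h01_deriv u D \<Longrightarrow> AE x in leb01. weak_deriv u x = D x"
  by (rule weak_deriv_AE[OF h01_deriv_L2(1) h01_deriv_has_weak_deriv])

text \<open>Any explicit derivative may stand in for the chosen weak derivative, because the two
  agree almost everywhere; this makes the form computable on hats.\<close>

lemma L_op_apply:
  assumes u: "h01_deriv u D" and v: "h01_deriv v E"
  shows "L_op n u v = (LINT x|leb01. D x * E x) - 4 * real n * (\<Sum>k = 1..n - 1. u (real k / real n) * v (real k / real n))"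
proof -
  have H: "u \<in> H01" "v \<in> H01" using u v by (auto intro: h01_deriv_imp_H01)
  note wd = h01_deriv_L2(1)[OF H01_h01_deriv[OF H(1)]] h01_deriv_L2(1)[OF H01_h01_deriv[OF H(2)]]
  have "(LINT x|leb01. weak_deriv u x * weak_deriv v x) = (LINT x|leb01. D x * E x)"
  proof (rule integral_cong_AE)
    show "AE x in leb01. weak_deriv u x * weak_deriv v x = D x * E x"
      using h01_deriv_weak_deriv_AE[OF u] h01_deriv_weak_deriv_AE[OF v] by eventually_elim simp
  qed (intro borel_measurable_times L2_01_measurable wd h01_deriv_L2(1)[OF u] h01_deriv_L2(1)[OF v])+
  then show ?thesis using H by (simp add: L_op_def neg_dxx_def delta_mult_def)
qed

lemma H01_add: "u \<in> H01 \<Longrightarrow> v \<in> H01 \<Longrightarrow> (\<lambda>x. u x + v x) \<in> H01"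
  using h01_deriv_imp_H01[OF h01_deriv_lincomb[OF H01_h01_deriv H01_h01_deriv], of u v 1 1] by simp

lemma H01_scale: "u \<in> H01 \<Longrightarrow> (\<lambda>x. c * u x) \<in> H01"
  using h01_deriv_imp_H01[OF h01_deriv_lincomb[OF H01_h01_deriv H01_h01_deriv], of u u c 0] by simp

lemma H01_L2_01: "u \<in> H01 \<Longrightarrow> u \<in> L2_01"
  by (rule h01_deriv_L2(2)[OF H01_h01_deriv])

lemma sqrt_sqint_le_H1_norm: "sqrt (sqint u) \<le> H1_norm u"
  unfolding H1_norm_def by (simp add: sqint_nonneg flip: sqint_def)

text \<open>The definition of an eigenvalue asks for T U in the dual space. For an eigenfunction, T
  U equals this functional, whose boundedness comes from Cauchy-Schwarz in L2.\<close>

lemma scaled_Hm1_of_in_Hm1: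
  assumes "u \<in> H01" shows "(\<lambda>\<phi>\<in>H01. \<mu> * Hm1_of u \<phi>) \<in> Hm1"
  unfolding Hm1_def
proof (intro CollectI conjI ballI allI)
  have [simp]: "integrable leb01 (\<lambda>x. u x * \<phi> x)" if "\<phi> \<in> H01" for \<phi>
    using assms that by (intro L2_01_mult_integrable H01_L2_01)
  let ?F = "\<lambda>\<phi>\<in>H01. \<mu> * Hm1_of u \<phi>"
  show "?F (\<lambda>x. \<phi> x + \<psi> x) = ?F \<phi> + ?F \<psi>" if "\<phi> \<in> H01" "\<psi> \<in> H01" for \<phi> \<psi>
    using that H01_add[OF that] by (simp add: Hm1_of_def distrib_left)
  show "?F (\<lambda>x. c * \<phi> x) = c * ?F \<phi>" if "\<phi> \<in> H01" for \<phi> c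
    using that H01_scale[OF that, of c] by (simp add: Hm1_of_def mult.left_commute)
  show "\<exists>C. \<forall>\<phi>\<in>H01. \<bar>?F \<phi>\<bar> \<le> C * H1_norm \<phi>"
  proof (intro exI ballI)
    fix \<phi> assume \<phi>: "\<phi> \<in> H01"
    have "\<bar>LINT x|leb01. u x * \<phi> x\<bar> \<le> sqrt (sqint u) * sqrt (sqint \<phi>)"
      using assms \<phi> by (intro L2_01_Cauchy_Schwarz H01_L2_01)
    also have "\<dots> \<le> sqrt (sqint u) * H1_norm \<phi>"
      by (intro mult_left_mono sqrt_sqint_le_H1_norm) (simp add: sqint_nonneg)
    finally show "\<bar>?F \<phi>\<bar> \<le> \<bar>\<mu>\<bar> * sqrt (sqint u) * H1_norm \<phi>"
      using \<phi> by (simp add: Hm1_of_def abs_mult mult.assoc mult_left_mono)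
  qed
qed auto

text \<open>The eigenvalue equation in variational form, with the delta terms on the right. Carrying
  \<open>D\<close> along allows explicit derivatives in place of the arbitrary choice
  \<open>weak_deriv\<close>.\<close>

definition weak_eigenpair :: "nat \<Rightarrow> real \<Rightarrow> (real \<Rightarrow> real) \<Rightarrow> (real \<Rightarrow> real) \<Rightarrow> bool" where
  "weak_eigenpair n \<mu> u D \<longleftrightarrow> h01_deriv u D \<and> u \<noteq> (\<lambda>x. 0) \<and>
     (\<forall>v E. h01_deriv v E \<longrightarrow> (LINT x|leb01. D x * E x) - \<mu> * (LINT x|leb01. u x * v x) =
        4 * real n * (\<Sum>k = 1..n - 1. u (real k / real n) * v (real k / real n)))"

lemma is_eigenvalue_iff: "is_eigenvalue (L_op n) \<mu> \<longleftrightarrow> (\<exists>u D. weak_eigenpair n \<mu> u D)"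
proof
  assume "is_eigenvalue (L_op n) \<mu>"
  then obtain u where u: "u \<in> H01" "u \<noteq> (\<lambda>x. 0)" "L_op n u = (\<lambda>\<phi>\<in>H01. \<mu> * Hm1_of u \<phi>)"
    unfolding is_eigenvalue_def by blast
  note h = H01_h01_deriv[OF u(1)]
  have "(LINT x|leb01. weak_deriv u x * E x) - \<mu> * (LINT x|leb01. u x * v x) =
        4 * real n * (\<Sum>k = 1..n - 1. u (real k / real n) * v (real k / real n))" if v: "h01_deriv v E" for v E
    using L_op_apply[OF h v, of n] h01_deriv_imp_H01[OF v] by (simp add: u(3) Hm1_of_def)
  then show "\<exists>u D. weak_eigenpair n \<mu> u D"
    using h u(2) unfolding weak_eigenpair_def by blast
next
  assume "\<exists>u D. weak_eigenpair n \<mu> u D"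
  then obtain u D where u: "h01_deriv u D" "u \<noteq> (\<lambda>x. 0)" and
    eq: "\<And>v E. h01_deriv v E \<Longrightarrow> (LINT x|leb01. D x * E x) - \<mu> * (LINT x|leb01. u x * v x) =
        4 * real n * (\<Sum>k = 1..n - 1. u (real k / real n) * v (real k / real n))"
    unfolding weak_eigenpair_def by blast
  note H = h01_deriv_imp_H01[OF u(1)]
  have "L_op n u = (\<lambda>\<phi>\<in>H01. \<mu> * Hm1_of u \<phi>)"
  proof
    fix \<phi>
    show "L_op n u \<phi> = (\<lambda>\<phi>\<in>H01. \<mu> * Hm1_of u \<phi>) \<phi>"
    proof (cases "\<phi> \<in> H01")
      case True
      then show ?thesis
        using L_op_apply[OF u(1) H01_h01_deriv[OF True], of n] eq[OF H01_h01_deriv[OF True]]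
        by (simp add: Hm1_of_def)
    next
      case False
      then show ?thesis by (simp add: L_op_def)
    qed
  qed
  then show "is_eigenvalue (L_op n) \<mu>"
    using H u(2) scaled_Hm1_of_in_Hm1[OF H] unfolding is_eigenvalue_def by metis
qed

text \<open>The index is shifted: for k \<ge> 1 this is the classical U of index k - 1, with value
  sin(k \<theta>) / sin \<theta> at cos \<theta>. The initial values 0 and 1 match a grid function
  that vanishes at the left end.\<close>

fun chebyshev_U :: "nat \<Rightarrow> real poly" where
  "chebyshev_U 0 = 0"
| "chebyshev_U (Suc 0) = 1"
| "chebyshev_U (Suc (Suc k)) = [:0, 2:] * chebyshev_U (Suc k) - chebyshev_U k"

text \<open>This certifies for k > 0 that the polynomial is nonzero and so has finitely many
  roots.\<close>

lemma poly_chebyshev_U_1: "poly (chebyshev_U k) 1 = real k"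
  by (induction k rule: chebyshev_U.induct) auto

text \<open>At c = -1 the recurrence has a solution of linear growth with alternating sign, which
  does not return to zero; this rules out the eigenvalue 0.\<close>

lemma poly_chebyshev_U_minus_1: "poly (chebyshev_U k) (-1) = (-1) ^ Suc k * real k"
  by (induction k rule: chebyshev_U.induct) (auto simp: algebra_simps)

text \<open>With w 0 = 0 fixed, the solutions of the second-order recurrence form a line, spanned by
  the Chebyshev values.\<close>

lemma chebyshev_U_recurrence:
  fixes w :: "nat \<Rightarrow> real"
  assumes "w 0 = 0" "\<And>k. 1 \<le> k \<Longrightarrow> k < n \<Longrightarrow> w (Suc k) = 2 * c * w k - w (k - 1)" "k \<le> n"
  shows "w k = w 1 * poly (chebyshev_U k) c"
  using assms(3)
proof (induction k rule: chebyshev_U.induct)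
  case (3 k)
  then show ?case using assms(2)[of "Suc k"] by (simp add: algebra_simps)
qed (use assms(1) in auto)

text \<open>A discrete Green identity: \<open>W\<close> is the discrete Wronskian, its increments
  are the differences of the two summands, and it vanishes at both ends.\<close>

lemma sum_shift_symmetric:
  fixes u v :: "nat \<Rightarrow> real"
  assumes "n \<ge> 1" "u 0 = 0" "u n = 0" "v 0 = 0" "v n = 0"
  shows "(\<Sum>k = 1..n - 1. u k * (v (k - 1) + v (k + 1))) = (\<Sum>k = 1..n - 1. v k * (u (k - 1) + u (k + 1)))"
proof -
  define W where "W k = u k * v (Suc k) - u (Suc k) * v k" for k
  have "(\<Sum>k = 1..n - 1. u k * (v (k - 1) + v (k + 1))) - (\<Sum>k = 1..n - 1. v k * (u (k - 1) + u (k + 1)))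
    = (\<Sum>k = Suc 0..n - 1. W k - W (k - 1))"
    unfolding sum_subtractf[symmetric] by (rule sum.cong) (auto simp: W_def algebra_simps)
  also have "\<dots> = W (n - 1) - W 0" by (rule sum_telescope'') simp
  also have "\<dots> = 0" using assms by (simp add: W_def)
  finally show ?thesis by simp
qed

section \<open>Eigenvalues and their grid values\<close>

locale hat_grid = hat_profile \<sigma> \<tau> q "1 / real n"
  for \<sigma> \<tau> :: "real \<Rightarrow> real" and q :: real and n :: nat +
  assumes n_ge_2: "n \<ge> 2"
begin

abbreviation "hats k \<equiv> hat \<sigma> (1 / real n) (real k / real n)"
abbreviation "dhats k \<equiv> dhat \<tau> (1 / real n) (real k / real n)"

lemma grid_neighbours:
  assumes "k \<in> {1..n - 1}"
  shows "real k / real n - 1 / real n = real (k - 1) / real n" "real k / real n + 1 / real n = real (k + 1) / real n"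
    "0 \<le> real k / real n - 1 / real n" "real k / real n + 1 / real n \<le> 1"
  using assms n_ge_2 by (auto simp: field_simps of_nat_diff)

lemma hats_h01_deriv: "k \<in> {1..n - 1} \<Longrightarrow> h01_deriv (hats k) (dhats k)"
  using grid_neighbours by (intro h01_deriv_hat)

lemma hats_green:
  assumes "k \<in> {1..n - 1}" "h01_deriv u D"
  shows "(LINT x|leb01. dhats k x * D x) + q * (LINT x|leb01. hats k x * u x) =
    2 * \<tau> (1 / n) * u (real k / real n) - u (real (k - 1) / n) - u (real (k + 1) / n)"
  using hat_green[OF grid_neighbours(3,4)[OF assms(1)] assms(2)] grid_neighbours(1,2)[OF assms(1)] by simp

text \<open>Other nodes lie at distance at least 1/n, where the strict inequality in
  \<open>hat\<close> fails. Testing with one hat therefore isolates one term of the delta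
  sum.\<close>

lemma hats_grid: "hats k (real j / real n) = (if j = k then \<sigma> (1 / n) else 0)"
proof -
  have "real j / real n - real k / real n = (real j - real k) / real n" by (simp add: diff_divide_distrib)
  moreover have "\<bar>real j - real k\<bar> \<ge> 1" if "j \<noteq> k" using that by linarith
  ultimately show ?thesis using n_ge_2
    by (auto simp: hat_def abs_divide divide_less_cancel)
qed

lemma eigenvalue_imp_root:
  assumes q: "0 \<le> q" and ev: "is_eigenvalue (L_op n) (- q)"
  shows "poly (chebyshev_U n) (\<tau> (1 / n) - 2 * n * \<sigma> (1 / n)) = 0"
proof (rule ccontr)
  define c where "c = \<tau> (1 / n) - 2 * n * \<sigma> (1 / n)"
  assume "poly (chebyshev_U n) (\<tau> (1 / n) - 2 * n * \<sigma> (1 / n)) \<noteq> 0"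
  then have nz: "poly (chebyshev_U n) c \<noteq> 0" by (simp add: c_def)
  obtain u D where u: "h01_deriv u D" "u \<noteq> (\<lambda>x. 0)" and
    eq: "\<And>v E. h01_deriv v E \<Longrightarrow> (LINT x|leb01. D x * E x) - (- q) * (LINT x|leb01. u x * v x) =
        4 * real n * (\<Sum>k = 1..n - 1. u (real k / real n) * v (real k / real n))"
    using ev unfolding is_eigenvalue_iff weak_eigenpair_def by blast
  define w where "w k = u (real k / real n)" for k
  have u0: "u x = 0" if "x \<notin> {0<..<1}" for x using u(1) that unfolding h01_deriv_def by blast
  have w0: "w 0 = 0" "w n = 0" using n_ge_2 by (auto simp: w_def u0)
  have "w (Suc k) = 2 * c * w k - w (k - 1)" if "1 \<le> k" "k < n" for k
  proof -
    have k: "k \<in> {1..n - 1}" using that by auto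
    have "(\<Sum>j = 1..n - 1. u (real j / real n) * hats k (real j / real n)) = (\<Sum>j = 1..n - 1. if j = k then w k * \<sigma> (1 / n) else 0)"
      by (rule sum.cong) (auto simp: hats_grid w_def)
    also have "\<dots> = w k * \<sigma> (1 / n)" using k by simp
    \<comment> \<open>The delta sum has collapsed to one term; moved to the other side, it turns 2
      \<tau>(h) into 2 \<tau>(h) - 4 n \<sigma>(h) = 2 c.\<close>
    finally have "4 * real n * (w k * \<sigma> (1 / n)) = 2 * \<tau> (1 / n) * w k - w (k - 1) - w (Suc k)"
      using eq[OF hats_h01_deriv[OF k]] hats_green[OF k u(1)] by (simp add: w_def mult.commute)
    then show ?thesis by (simp add: c_def algebra_simps)
  qed
  then have w: "w k = w 1 * poly (chebyshev_U k) c" if "k \<le> n" for k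
    using chebyshev_U_recurrence[of w n c k] w0 that by blast
  \<comment> \<open>At k = n the left-hand side is the boundary value 0, while the Chebyshev factor
    is nonzero.\<close>
  then have "w 1 = 0" using nz w0 by force
  then have "w k = 0" if "k \<le> n" for k using w[OF that] by simp
  then have "(\<Sum>k = 1..n - 1. u (real k / real n) * u (real k / real n)) = 0"
    by (intro sum.neutral) (auto simp: w_def)
  then have "sqint D + q * sqint u = 0"
    using eq[OF u(1)] by (simp add: sqint_def power2_eq_square)
  then have "sqint D = 0"
    using q sqint_nonneg[of D] mult_nonneg_nonneg[OF q sqint_nonneg[of u]] by linarith
  \<comment> \<open>The supremum bound for primitives turns the zero norm of \<open>D\<close> into u
    = 0.\<close>
  then have "u x = 0" for x
    using u(1) u0[of x] abs_primitive_le[OF h01_deriv_L2(1)[OF u(1)], of x] unfolding h01_deriv_def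
    by (cases "x \<in> {0<..<1}") auto
  then show False using u(2) by blast
qed

text \<open>The vector of sines is the ground state of the discrete Dirichlet problem. Since
  \<sigma>(1/n) is nonzero, the combination of hats is nonzero at the first node and hence is a
  genuine eigenfunction.\<close>

lemma root_imp_eigenvalue:
  assumes c: "\<tau> (1 / n) - 2 * n * \<sigma> (1 / n) = cos (pi / n)" and s: "\<sigma> (1 / n) \<noteq> 0"
  shows "is_eigenvalue (L_op n) (- q)"
proof -
  define s where "s k = sin (real k * pi / real n)" for k
  have s0: "s 0 = 0" "s n = 0" using n_ge_2 by (auto simp: s_def)
  have srec: "s (k - 1) + s (k + 1) = 2 * cos (pi / n) * s k" if "k \<ge> 1" for k
  proof -
    have "real (k - 1) * pi / real n = real k * pi / real n - pi / real n"
      "real (k + 1) * pi / real n = real k * pi / real n + pi / real n"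
      using that by (simp_all add: of_nat_diff left_diff_distrib distrib_right add_divide_distrib diff_divide_distrib)
    then show ?thesis by (simp only: s_def sin_add sin_diff) simp
  qed
  define u D where "u x = (\<Sum>k = 1..n - 1. s k * hats k x)"
    and "D x = (\<Sum>k = 1..n - 1. s k * dhats k x)" for x
  have u: "h01_deriv u D"
    unfolding u_def[abs_def] D_def[abs_def] by (rule h01_deriv_sum) (auto intro: hats_h01_deriv)
  have ugrid: "u (real j / real n) = s j * \<sigma> (1 / n)" if "j \<in> {1..n - 1}" for j
  proof -
    have "u (real j / real n) = (\<Sum>k = 1..n - 1. if k = j then s j * \<sigma> (1 / n) else 0)"
      unfolding u_def by (rule sum.cong) (auto simp: hats_grid)
    then show ?thesis using that by simp
  qed
  have "s 1 > 0" unfolding s_def using n_ge_2 by (intro sin_gt_zero) (auto simp: field_simps)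
  then have "u (real 1 / real n) \<noteq> 0" using ugrid[of 1] n_ge_2 s by simp
  then have unz: "u \<noteq> (\<lambda>x. 0)" by metis
  have "(LINT x|leb01. D x * E x) - (- q) * (LINT x|leb01. u x * v x) =
        4 * real n * (\<Sum>k = 1..n - 1. u (real k / real n) * v (real k / real n))" if v: "h01_deriv v E" for v E
  proof -
    define w where "w k = v (real k / real n)" for k
    have w0: "w 0 = 0" "w n = 0" using v n_ge_2 unfolding h01_deriv_def by (auto simp: w_def)
    note vL2 = h01_deriv_L2[OF v] and hL2 = h01_deriv_L2[OF hats_h01_deriv]
    have "(LINT x|leb01. D x * E x) = (LINT x|leb01. (\<Sum>k = 1..n - 1. s k * (dhats k x * E x)))"
      by (simp add: D_def sum_distrib_right mult.assoc)
    also have "\<dots> = (\<Sum>k = 1..n - 1. s k * (LINT x|leb01. dhats k x * E x))"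
      by (subst Bochner_Integration.integral_sum) (auto intro!: L2_01_mult_integrable vL2 hL2)
    finally have 1: "(LINT x|leb01. D x * E x) = (\<Sum>k = 1..n - 1. s k * (LINT x|leb01. dhats k x * E x))" .
    have "(LINT x|leb01. u x * v x) = (LINT x|leb01. (\<Sum>k = 1..n - 1. s k * (hats k x * v x)))"
      by (simp add: u_def sum_distrib_right mult.assoc)
    also have "\<dots> = (\<Sum>k = 1..n - 1. s k * (LINT x|leb01. hats k x * v x))"
      by (subst Bochner_Integration.integral_sum) (auto intro!: L2_01_mult_integrable vL2 hL2)
    finally have 2: "(LINT x|leb01. u x * v x) = (\<Sum>k = 1..n - 1. s k * (LINT x|leb01. hats k x * v x))" .
    have "(LINT x|leb01. D x * E x) - (- q) * (LINT x|leb01. u x * v x) =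
        (\<Sum>k = 1..n - 1. s k * ((LINT x|leb01. dhats k x * E x) + q * (LINT x|leb01. hats k x * v x)))"
      unfolding 1 2 by (simp add: sum_distrib_left distrib_left sum.distrib mult.left_commute sum_negf)
    also have "\<dots> = (\<Sum>k = 1..n - 1. s k * (2 * \<tau> (1 / n) * w k - w (k - 1) - w (k + 1)))"
      by (rule sum.cong) (simp_all only: hats_green[OF _ v] w_def)
    also have "\<dots> = (\<Sum>k = 1..n - 1. 2 * \<tau> (1 / n) * (s k * w k)) - (\<Sum>k = 1..n - 1. s k * (w (k - 1) + w (k + 1)))"
      unfolding sum_subtractf[symmetric] by (rule sum.cong) (auto simp: algebra_simps)
    \<comment> \<open>Summation by parts moves the neighbour sum from the arbitrary values
      \<open>w\<close> to \<open>s\<close>, where the sine recurrence applies.\<close>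
    also have "(\<Sum>k = 1..n - 1. s k * (w (k - 1) + w (k + 1))) = (\<Sum>k = 1..n - 1. w k * (s (k - 1) + s (k + 1)))"
      by (rule sum_shift_symmetric) (use n_ge_2 s0 w0 in auto)
    also have "\<dots> = (\<Sum>k = 1..n - 1. w k * (2 * cos (pi / n) * s k))"
      by (rule sum.cong) (simp_all only: srec atLeastAtMost_iff)
    \<comment> \<open>The root condition enters here: 2 \<tau>(h) - 2 cos(pi / n) = 4 n
      \<sigma>(h).\<close>
    also have "(\<Sum>k = 1..n - 1. 2 * \<tau> (1 / n) * (s k * w k)) - (\<Sum>k = 1..n - 1. w k * (2 * cos (pi / n) * s k)) =
        (\<Sum>k = 1..n - 1. 4 * real n * ((s k * \<sigma> (1 / n)) * w k))"
      unfolding sum_subtractf[symmetric] c[symmetric] by (rule sum.cong) (auto simp: algebra_simps)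
    also have "\<dots> = 4 * real n * (\<Sum>k = 1..n - 1. u (real k / real n) * v (real k / real n))"
      unfolding sum_distrib_left by (rule sum.cong) (simp_all add: ugrid w_def)
    finally show ?thesis .
  qed
  then show ?thesis using u unz unfolding is_eigenvalue_iff weak_eigenpair_def by blast
qed

end

section \<open>The linear and hyperbolic profiles and the dispersion function\<close>

lemma hat_grid_linear: "n \<ge> 2 \<Longrightarrow> hat_grid (\<lambda>t. t) (\<lambda>t. 1) 0 n"
  by unfold_locales (auto intro: elem_smooth.const)

lemma hat_grid_hyperbolic:
  assumes "n \<ge> 2" "\<kappa> > 0"
  shows "hat_grid (\<lambda>t. sinh (\<kappa> * t) / \<kappa>) (\<lambda>t. cosh (\<kappa> * t)) (\<kappa>\<^sup>2) n"
proof unfold_locales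
  have "(\<lambda>t. exp (\<kappa> * t + 0) * (1/2) + exp (- \<kappa> * t + 0) * (1/2)) \<in> elem_smooth"
    by (intro elem_smooth.intros)
  then show "(\<lambda>t. cosh (\<kappa> * t)) \<in> elem_smooth" by (simp add: cosh_field_def add_divide_distrib)
  show "((\<lambda>t. sinh (\<kappa> * t) / \<kappa>) has_field_derivative cosh (\<kappa> * t)) (at t)" for t
    using assms by (auto intro!: derivative_eq_intros)
  show "((\<lambda>t. cosh (\<kappa> * t)) has_field_derivative \<kappa>\<^sup>2 * (sinh (\<kappa> * t) / \<kappa>)) (at t)" for t
    using assms by (auto intro!: derivative_eq_intros simp: power2_eq_square)
qed (use assms in auto)

text \<open>The quantity c as a function of s = \<kappa> / n. The factor n of the coupling is
  absorbed by the scaling, so one function serves all n.\<close>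

definition dispersion :: "real \<Rightarrow> real" where "dispersion s = cosh s - 2 * sinh s / s"

text \<open>The derivative is N(x) / x^2, where N(0) = 0 and N has derivative x^2 cosh x > 0. It
  makes distinct negative \<mu> give distinct values of c.\<close>

lemma dispersion_strict_mono:
  assumes "0 < s" "s < t" shows "dispersion s < dispersion t"
proof -
  define N where "N x = x\<^sup>2 * sinh x - 2 * x * cosh x + 2 * sinh x" for x :: real
  have N: "N x > 0" if "x > 0" for x
  proof -
    have "N 0 < N x"
    proof (rule DERIV_pos_imp_increasing_open[OF that])
      fix y assume y: "0 < y" "y < x"
      have "(N has_field_derivative y\<^sup>2 * cosh y) (at y)"
        unfolding N_def by (auto intro!: derivative_eq_intros simp: algebra_simps)
      moreover have "y\<^sup>2 * cosh y > 0" using y by simp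
      ultimately show "\<exists>d. (N has_field_derivative d) (at y) \<and> d > 0" by blast
    qed (auto simp: N_def intro!: continuous_intros)
    then show ?thesis by (simp add: N_def)
  qed
  show ?thesis
  proof (rule DERIV_pos_imp_increasing[OF assms(2)])
    fix x assume "s \<le> x" "x \<le> t"
    then have x: "x > 0" using assms by simp
    have "((\<lambda>s. cosh s - 2 * sinh s / s) has_field_derivative
        sinh x - (2 * cosh x * x - 2 * sinh x) / (x * x)) (at x)"
      using x by (auto intro!: derivative_eq_intros)
    also have "sinh x - (2 * cosh x * x - 2 * sinh x) / (x * x) = N x / x\<^sup>2"
      using x by (simp add: N_def power2_eq_square diff_divide_distrib add_divide_distrib)
    finally have "(dispersion has_field_derivative N x / x\<^sup>2) (at x)"
      by (simp add: dispersion_def[abs_def])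
    moreover have "N x / x\<^sup>2 > 0" using N[OF x] x by simp
    ultimately show "\<exists>d. (dispersion has_field_derivative d) (at x) \<and> d > 0" by blast
  qed
qed

lemma dispersion_eq:
  assumes "n \<ge> 2" "\<kappa> > 0"
  shows "cosh (\<kappa> * (1 / n)) - 2 * real n * (sinh (\<kappa> * (1 / n)) / \<kappa>) = dispersion (\<kappa> / n)"
  using assms by (simp add: dispersion_def field_simps)

text \<open>Values in [0, 1] are enough for \<open>cos (pi / n)\<close> with n \<ge> 2. On the
  bracket [1, 4] the endpoint estimates follow from exp x \<ge> 1 + x alone.\<close>

lemma dispersion_surj:
  assumes "0 \<le> c" "c \<le> 1" obtains s where "s > 0" "dispersion s = c"
proof -
  have "\<exists>s. 1 \<le> s \<and> s \<le> 4 \<and> dispersion s = c"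
  proof (rule IVT')
    \<comment> \<open>The claim at 1 amounts to exp 2 \<ge> 3.\<close>
    have "exp (1::real) \<ge> 2" using exp_ge_add_one_self[of "1::real"] by simp
    then have "exp (1::real) * exp 1 \<ge> 2 * 2" by (intro mult_mono) auto
    then have "dispersion 1 \<le> 0"
      by (simp add: dispersion_def cosh_field_def sinh_field_def exp_minus field_simps)
    then show "dispersion 1 \<le> c" using assms by simp
    have "exp (4::real) \<ge> 5" using exp_ge_add_one_self[of "4::real"] by simp
    moreover have "exp (-4::real) > 0" by (rule exp_gt_zero)
    moreover have "dispersion 4 = exp 4 / 4 + 3 / 4 * exp (-4)"
      by (simp add: dispersion_def cosh_field_def sinh_field_def field_simps)
    ultimately have "dispersion 4 \<ge> 1" by linarith
    then show "c \<le> dispersion 4" using assms by simp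
  qed (auto simp: dispersion_def intro!: continuous_intros)
  then obtain s where "1 \<le> s" "dispersion s = c" by blast
  then show ?thesis by (intro that[of s]) auto
qed

section \<open>The spectrum at and below zero\<close>

theorem lemma13:
  fixes n :: nat
  assumes "n \<ge> 2"
  shows "(\<exists>\<mu><0. is_eigenvalue (L_op n) \<mu>) \<and>
         finite {\<mu>. \<mu> < 0 \<and> is_eigenvalue (L_op n) \<mu>} \<and>
         \<not> is_eigenvalue (L_op n) 0"
proof (intro conjI)
  have n: "real n > 0" using assms by simp
  \<comment> \<open>The angle is at most a right angle, so the target value is nonnegative and
    \<open>dispersion_surj\<close> reaches it.\<close>
  have "pi / n \<le> pi / 2" "0 \<le> pi / n" using assms by (auto simp: field_simps)
  then have "0 \<le> cos (pi / n)" by (intro cos_ge_zero) (use pi_gt_zero in linarith)+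
  then obtain s where s: "s > 0" "dispersion s = cos (pi / n)"
    using dispersion_surj[of "cos (pi / n)"] by auto
  \<comment> \<open>Undoes the scaling s = \<kappa> / n.\<close>
  define \<kappa> where "\<kappa> = s * n"
  have \<kappa>: "\<kappa> > 0" "\<kappa> / n = s" using s n by (auto simp: \<kappa>_def)
  interpret hat_grid "\<lambda>t. sinh (\<kappa> * t) / \<kappa>" "\<lambda>t. cosh (\<kappa> * t)" "\<kappa>\<^sup>2" n
    using assms \<kappa>(1) by (rule hat_grid_hyperbolic)
  have "is_eigenvalue (L_op n) (- \<kappa>\<^sup>2)"
    by (rule root_imp_eigenvalue) (use dispersion_eq[OF assms \<kappa>(1)] s \<kappa> n in auto)
  then show "\<exists>\<mu><0. is_eigenvalue (L_op n) \<mu>" using \<kappa>(1) by (intro exI[of _ "- \<kappa>\<^sup>2"]) auto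
next
  \<comment> \<open>\<open>f\<close> sends a negative eigenvalue to its c. The images are roots of
    one fixed nonzero polynomial and \<open>f\<close> is injective, whence finiteness.\<close>
  define f where "f \<mu> = dispersion (sqrt (- \<mu>) / n)" for \<mu>
  have "f ` {\<mu>. \<mu> < 0 \<and> is_eigenvalue (L_op n) \<mu>} \<subseteq> {x. poly (chebyshev_U n) x = 0}"
  proof safe
    fix \<mu> :: real assume \<mu>: "\<mu> < 0" "is_eigenvalue (L_op n) \<mu>"
    define \<kappa> where "\<kappa> = sqrt (- \<mu>)"
    have \<kappa>: "\<kappa> > 0" "- \<kappa>\<^sup>2 = \<mu>" using \<mu> by (auto simp: \<kappa>_def)
    interpret hat_grid "\<lambda>t. sinh (\<kappa> * t) / \<kappa>" "\<lambda>t. cosh (\<kappa> * t)" "\<kappa>\<^sup>2" n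
      using assms \<kappa>(1) by (rule hat_grid_hyperbolic)
    show "poly (chebyshev_U n) (f \<mu>) = 0"
      using eigenvalue_imp_root \<mu>(2) \<kappa>(2) dispersion_eq[OF assms \<kappa>(1)] by (simp add: f_def \<kappa>_def)
  qed
  moreover have "chebyshev_U n \<noteq> 0"
    using poly_chebyshev_U_1[of n] assms by auto
  ultimately have "finite (f ` {\<mu>. \<mu> < 0 \<and> is_eigenvalue (L_op n) \<mu>})"
    using poly_roots_finite finite_subset by blast
  moreover have "inj_on f {\<mu>. \<mu> < 0 \<and> is_eigenvalue (L_op n) \<mu>}"
  proof (rule inj_onI)
    fix \<mu> \<nu> assume "\<mu> \<in> {\<mu>. \<mu> < 0 \<and> is_eigenvalue (L_op n) \<mu>}" "\<nu> \<in> {\<mu>. \<mu> < 0 \<and> is_eigenvalue (L_op n) \<mu>}"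
    then have neg: "\<mu> < 0" "\<nu> < 0" by auto
    then have pos: "sqrt (- \<mu>) / n > 0" "sqrt (- \<nu>) / n > 0" using assms by auto
    assume "f \<mu> = f \<nu>"
    then have "sqrt (- \<mu>) / n = sqrt (- \<nu>) / n"
      using dispersion_strict_mono[OF pos(1), of "sqrt (- \<nu>) / n"] dispersion_strict_mono[OF pos(2), of "sqrt (- \<mu>) / n"]
      unfolding f_def by linarith
    then show "\<mu> = \<nu>" using assms by simp
  qed
  ultimately show "finite {\<mu>. \<mu> < 0 \<and> is_eigenvalue (L_op n) \<mu>}" by (rule finite_imageD)
next
  interpret hat_grid "\<lambda>t. t" "\<lambda>t. 1" 0 n using assms by (rule hat_grid_linear)
  show "\<not> is_eigenvalue (L_op n) 0"
  proof
    assume "is_eigenvalue (L_op n) 0"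
    \<comment> \<open>The linear profile has \<tau> = 1 and \<sigma>(1/n) = 1/n, so c = 1 - 2 n / n
      = -1.\<close>
    then have "poly (chebyshev_U n) (-1) = 0" using eigenvalue_imp_root assms by simp
    then show False using assms by (simp add: poly_chebyshev_U_minus_1)
  qed
qed

end
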